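(* Let $X$ be a Markov process in $E\cup\{\partial\}$ absorbed at $\partial$. Assume that there exist a time $t_0>0$, a constant $c>0$, a probability measure $\mu$ on $E$ and a measurable function $f:E\to(0,+\infty)$ such that $$c^{-1}f(x)\mu(\cdot)\leq \mathbb{P}_x(X_{t_0}\in\cdot)\leq c f(x)\mu(\cdot),\qquad \forall x\in E,$$ as an inequality between measures on $E$. Then: (i) Condition (A) is satisfied with this $t_0$, with $\nu=\mu$, $c_1=c^{-2}$ and $c_2=c^{-3}\mu(f)$; that is, for all $x\in E$, $\mathbb{P}_x(X_{t_0}\in\cdot\mid t_0<\tau_\partial)\geq c^{-2}\mu(\cdot)$, and for all $z\in E$ and all $t\geq 0$, $\mathbb{P}_\mu(t<\tau_\partial)\geq c^{-3}\mu(f)\,\mathbb{P}_z(t<\tau_\partial)$. (ii) For all probability measures $\pi_1$ and $\pi_2$ on $E$ and all $t\geq 0$, $$\left\|\mathbb{P}_{\pi_1}(X_t\in\cdot\mid t<\tau_\partial)-\mathbb{P}_{\pi_2}(X_t\in\cdot\mid t<\tau_\partial)\right\|_{TV}\leq c^3\,\frac{(1-c^{-5}\mu(f))^{\lfloor t/t_0\rfloor}}{\pi_1(f)\vee\pi_2(f)}\,\|\pi_1-\pi_2\|_{TV}.$$ (iii) The unique quasi-stationary distribution $\alpha$ of $X$ satisfies $c^{-2}\mu\leq\alpha\leq c^2\mu$.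
   Context: $X=(X_t)_{t\geq 0}$ is a (time-homogeneous) Markov process in a measurable state space $E\cup\{\partial\}$, $\partial\notin E$, absorbed at $\partial$ at time $\tau_\partial=\inf\{t\geq 0: X_t=\partial\}$ (so $X_t=\partial$ for all $t\geq\tau_\partial$). $\mathbb{P}_x$ denotes the law of $X$ started at $x$, and $\mathbb{P}_\pi=\int_E\mathbb{P}_x\,\pi(dx)$ the law with initial distribution $\pi$, a probability measure on $E$. It is assumed that $\mathbb{P}_x(t<\tau_\partial)>0$ for all $x\in E$, $t\geq0$ (it is not assumed that $\mathbb{P}_x(\tau_\partial<\infty)=1$). $\|\cdot\|_{TV}$ is the total variation norm on finite signed measures; $\pi(f)=\int f\,d\pi$; $a\vee b=\max(a,b)$. Condition (A): there exist $t_0,c_1,c_2>0$ and a probability measure $\nu$ on $E$ such that (A1) for all $x\in E$, $\mathbb{P}_x(X_{t_0}\in\cdot\mid t_0<\tau_\partial)\geq c_1\nu(\cdot)$; (A2) for all $z\in E$ and all $t\geq0$, $\mathbb{P}_\nu(t<\tau_\partial)\geq c_2\mathbb{P}_z(t<\tau_\partial)$. A quasi-stationary distribution is a probability measure $\alpha$ on $E$ such that $\alpha(\cdot)=\mathbb{P}_\alpha(X_t\in\cdot\mid t<\tau_\partial)$ for all $t\geq0$. *)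

theory Defs
  imports "HOL-Probability.Probability"
begin

text \<open>
  The state space \<open>E \<union> {\<partial>}\<close>. A measure \<open>E\<close> on the type \<open>'a\<close> serves as the measurable space of
  non-absorbed states (only its space and its sets are used); \<open>d\<close> is the cemetery point \<open>\<partial>\<close>. The
  singleton \<open>{\<partial>}\<close> is measurable, and the trace of the sigma-algebra on \<open>E\<close> is \<open>sets E\<close>.
\<close>

definition cemetery_space :: "'a measure \<Rightarrow> 'a \<Rightarrow> 'a measure" where
  "cemetery_space E d = sigma (insert d (space E)) (insert {d} (sets E))"

definition absorption_time :: "(real \<Rightarrow> 'w \<Rightarrow> 'a) \<Rightarrow> 'a \<Rightarrow> 'w \<Rightarrow> ereal" where
  "absorption_time X d \<omega> = Inf (ereal ` {t. 0 \<le> t \<and> X t \<omega> = d})"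

definition history :: "'w measure \<Rightarrow> 'a measure \<Rightarrow> (real \<Rightarrow> 'w \<Rightarrow> 'a) \<Rightarrow> real \<Rightarrow> 'w measure" where
  "history M S X s =
     sigma (space M) {X u -` A \<inter> space M | u A. 0 \<le> u \<and> u \<le> s \<and> A \<in> sets S}"

text \<open>
  A time-homogeneous Markov process \<open>(X t)\<close>, \<open>t \<ge> 0\<close>, on the measurable space \<open>M\<close>, with the family
  of laws \<open>P x\<close> for \<open>x \<in> E \<union> {\<partial>}\<close>; the values of \<open>X t\<close> for negative \<open>t\<close> play no role. The
  starting condition is stated through the law of \<open>X 0\<close>, because singletons need not be measurable.
  The Markov property is the one with respect to the filtration generated by the process, hence it
  is implied by the Markov property with respect to any filtration to which \<open>X\<close> is adapted.
\<close>

locale absorbed_markov_process =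
  fixes E :: "'a measure" and d :: 'a and M :: "'w measure"
    and X :: "real \<Rightarrow> 'w \<Rightarrow> 'a" and P :: "'a \<Rightarrow> 'w measure"
  assumes cemetery: "d \<notin> space E"
    and measurable_X: "\<And>t. 0 \<le> t \<Longrightarrow> X t \<in> M \<rightarrow>\<^sub>M cemetery_space E d"
    and kernel_P: "P \<in> cemetery_space E d \<rightarrow>\<^sub>M prob_algebra M"
    and start: "\<And>x. x \<in> space (cemetery_space E d) \<Longrightarrow>
      distr (P x) (cemetery_space E d) (X 0) = return (cemetery_space E d) x"
    and markov: "\<And>x s t A. x \<in> space (cemetery_space E d) \<Longrightarrow> 0 \<le> s \<Longrightarrow> 0 \<le> t \<Longrightarrow>
      A \<in> sets (cemetery_space E d) \<Longrightarrow>
      AE \<omega> in P x. real_cond_exp (P x) (history M (cemetery_space E d) X s)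
          (indicator {\<omega> \<in> space M. X (s + t) \<omega> \<in> A}) \<omega> = \<P>(\<omega>' in P (X s \<omega>). X t \<omega>' \<in> A)"
    and absorbed: "\<And>\<omega> t. \<omega> \<in> space M \<Longrightarrow> 0 \<le> t \<Longrightarrow> absorption_time X d \<omega> \<le> ereal t \<Longrightarrow> X t \<omega> = d"
    and survival: "\<And>x t. x \<in> space E \<Longrightarrow> 0 \<le> t \<Longrightarrow>
      \<P>(\<omega> in P x. ereal t < absorption_time X d \<omega>) > 0"

text \<open>
  The probability measures on \<open>E\<close> are the elements of \<open>space (prob_algebra E)\<close>, and the law
  with initial distribution \<open>\<pi>\<close>, the mixture of the \<open>P x\<close> by \<open>\<pi>\<close>, is \<open>\<pi> \<bind> P\<close>.
\<close>

definition conditioned_law :: "(real \<Rightarrow> 'w \<Rightarrow> 'a) \<Rightarrow> 'a \<Rightarrow> 'w measure \<Rightarrow> real \<Rightarrow> 'a set \<Rightarrow> real" where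
  "conditioned_law X d Q t A = \<P>(\<omega> in Q. X t \<omega> \<in> A \<bar> ereal t < absorption_time X d \<omega>)"

definition condition_A ::
  "'a measure \<Rightarrow> 'a \<Rightarrow> (real \<Rightarrow> 'w \<Rightarrow> 'a) \<Rightarrow> ('a \<Rightarrow> 'w measure) \<Rightarrow>
    real \<Rightarrow> 'a measure \<Rightarrow> real \<Rightarrow> real \<Rightarrow> bool" where
  "condition_A E d X P t\<^sub>0 \<nu> c\<^sub>1 c\<^sub>2 \<longleftrightarrow>
     t\<^sub>0 > 0 \<and> c\<^sub>1 > 0 \<and> c\<^sub>2 > 0 \<and> \<nu> \<in> space (prob_algebra E) \<and>
     (\<forall>x\<in>space E. \<forall>A\<in>sets E. conditioned_law X d (P x) t\<^sub>0 A \<ge> c\<^sub>1 * measure \<nu> A) \<and>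
     (\<forall>z\<in>space E. \<forall>t\<ge>0. \<P>(\<omega> in \<nu> \<bind> P. ereal t < absorption_time X d \<omega>)
        \<ge> c\<^sub>2 * \<P>(\<omega> in P z. ereal t < absorption_time X d \<omega>))"

definition quasi_stationary ::
  "'a measure \<Rightarrow> 'a \<Rightarrow> (real \<Rightarrow> 'w \<Rightarrow> 'a) \<Rightarrow> ('a \<Rightarrow> 'w measure) \<Rightarrow> 'a measure \<Rightarrow> bool" where
  "quasi_stationary E d X P \<alpha> \<longleftrightarrow>
     \<alpha> \<in> space (prob_algebra E) \<and>
     (\<forall>t\<ge>0. \<forall>A\<in>sets E. measure \<alpha> A = conditioned_law X d (\<alpha> \<bind> P) t A)"

text \<open>
  Total variation norm of a finite signed measure \<open>m\<close> on \<open>E\<close>, given as a set function: its total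
  variation \<open>|m|(E)\<close>, normalised so that two mutually singular probability measures are at
  distance 2.
\<close>

definition tv_norm :: "'a measure \<Rightarrow> ('a set \<Rightarrow> real) \<Rightarrow> real" where
  "tv_norm E m =
     Sup {\<Sum>A\<in>\<A>. \<bar>m A\<bar> | \<A>. finite \<A> \<and> partition_on (space E) \<A> \<and> \<A> \<subseteq> sets E}"

end

theory Submission
  imports Defs
begin

text \<open>
  Killing the process at \<open>\<partial>\<close> gives a semigroup of sub-probability kernels \<open>Q t\<close> on \<open>E\<close>, and every
  conditional probability in the theorem is a quotient of integrals of functions \<open>x \<mapsto> Q t x A\<close>. Write
  \<open>surv t x = Q t x E\<close> for the survival probability. The whole argument is about the ratios
  \<open>Q t x A / surv t x = P\<^sub>x (X\<^sub>t \<in> A | t < \<tau>)\<close>.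

  The idea is a Birkhoff-type contraction. By Chapman and Kolmogorov, the ratio at time \<open>t\<^sub>0 + T\<close> from
  \<open>x\<close> is an average of the ratios at time \<open>T\<close>, with weight \<open>surv T\<close> against \<open>Q t\<^sub>0 x\<close>. The hypothesis
  says that \<open>Q t\<^sub>0 x\<close> is, up to the factors \<open>1/c\<close> and \<open>c\<close> and the scalar \<open>f x\<close>, the same measure \<open>\<mu>\<close>
  for all \<open>x\<close>. The scalar cancels in the quotient, so all these averages give weight at least
  \<open>1/c\<^sup>2\<close> to one common average \<open>a\<close>. Hence if the ratios at time \<open>T\<close> lie in \<open>[lo, hi]\<close>, those at time
  \<open>t\<^sub>0 + T\<close> lie in an interval that is shorter by the factor \<open>1 - 1/c\<^sup>2\<close>
  (\<open>ratio_band_contract\<close>). This rate is at least as good as the asserted \<open>1 - \<mu>(f)/c\<^sup>5\<close>, because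
  \<open>f \<le> c\<close> and \<open>c \<ge> 1\<close>.

  The minorisation half of condition (A) is the quotient of the two bounds at time \<open>t\<^sub>0\<close>. Its other
  half and the constant \<open>c\<^sup>3 / \<pi>(f)\<close> of the stability estimate both come from one comparison of survival
  probabilities, \<open>surv t z \<cdot> \<pi>(f) \<le> c\<^sup>3 \<pi>(surv t)\<close> (\<open>surv_le_mass\<close>), the former as the case \<open>\<pi> = \<mu>\<close>.

  For the stability estimate between initial laws \<open>\<pi>\<close> and \<open>\<pi>'\<close>, put
  \<open>\<theta> = \<pi>'(q) / \<pi>'(surv t)\<close> with \<open>q x = Q t x A\<close>. Then \<open>\<pi>'(q - \<theta> surv t) = 0\<close>,
  so the difference of the two conditional probabilities equals
  \<open>(\<pi> - \<pi>')(q - \<theta> surv t) / \<pi>(surv t)\<close>, and \<open>q - \<theta> surv t\<close> oscillates by at most the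
  supremum of \<open>surv t\<close> times the width of the band (\<open>conditional_difference_le\<close>).

  The quasi-stationary distribution arises as a limit: the shrinking bands make the ratios converge,
  uniformly in \<open>x\<close> and \<open>A\<close>, to a set function. It is dominated by \<open>c\<^sup>2 \<mu>\<close>, which makes it countably additive, and passing to the limit
  in the semigroup property makes it quasi-stationary (\<open>limit_law_invariant\<close>). Conversely the value
  of a quasi-stationary distribution at \<open>A\<close> is an average of the ratios at every time, so it lies in
  every band; this yields uniqueness and, from the band at time \<open>t\<^sub>0\<close>, the bounds by \<open>\<mu>\<close>.
\<close>

section \<open>Integrals and setwise comparison of measures\<close>

lemma layer_sum_bounds:
  fixes y :: real
  assumes "0 \<le> y" "y \<le> real n"
  shows "(\<Sum>j\<in>{1..n}. (if real j \<le> y then 1 else 0)) \<le> y"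
    and "y \<le> (\<Sum>j\<in>{1..n}. (if real j \<le> y then 1 else 0)) + 1"
proof -
  have "{j \<in> {1..n}. real j \<le> y} = {1..nat \<lfloor>y\<rfloor>}"
    using assms by (auto simp: le_nat_iff le_floor_iff)
  then have "(\<Sum>j\<in>{1..n}. (if real j \<le> y then 1 else 0)) = real (nat \<lfloor>y\<rfloor>)"
    by (simp add: sum.If_cases Int_def)
  then show "(\<Sum>j\<in>{1..n}. (if real j \<le> y then 1 else 0)) \<le> y"
    "y \<le> (\<Sum>j\<in>{1..n}. (if real j \<le> y then 1 else 0)) + 1"
    using assms by linarith+
qed

text \<open>
  Approximate \<open>h\<close> from below, within \<open>B/n\<close>, by \<open>B/n\<close> times the sum of the indicators of its \<open>n\<close> level
  sets; each level set contributes one instance of the setwise inequality. The case \<open>\<epsilon> = 0\<close> is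
  monotonicity of the integral in the measure, and \<open>a = b = 1\<close> compares integrals by total variation.
  The error term is \<open>\<epsilon> B\<close>, without a factor 2, because \<open>h\<close> is nonnegative.
\<close>

lemma integral_le_of_measure_le:
  fixes h :: "'a \<Rightarrow> real"
  assumes N: "finite_measure N\<^sub>1" "finite_measure N\<^sub>2" "sets N\<^sub>1 = sets E" "sets N\<^sub>2 = sets E"
    and "0 \<le> a" "0 \<le> b" "0 \<le> B"
    and le: "\<And>A. A \<in> sets E \<Longrightarrow> a * measure N\<^sub>1 A \<le> b * measure N\<^sub>2 A + \<epsilon>"
    and h [measurable]: "h \<in> borel_measurable E"
    and bnd: "\<And>x. x \<in> space E \<Longrightarrow> 0 \<le> h x \<and> h x \<le> B"
  shows "a * (\<integral>x. h x \<partial>N\<^sub>1) \<le> b * (\<integral>x. h x \<partial>N\<^sub>2) + \<epsilon> * B"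
proof (cases "B = 0")
  case True
  have "(\<integral>x. h x \<partial>N) = 0" if "sets N = sets E" for N
    using Bochner_Integration.integral_cong[of N N h "\<lambda>_. 0"] bnd True sets_eq_imp_space_eq[OF that] by force
  then show ?thesis using True N by simp
next
  case False
  then have B: "B > 0" using assms by simp
  have sp: "space N\<^sub>1 = space E" "space N\<^sub>2 = space E" using N sets_eq_imp_space_eq by blast+
  define K where "K = a * B * measure N\<^sub>1 (space E)"
  have step: "a * (\<integral>x. h x \<partial>N\<^sub>1) \<le> b * (\<integral>x. h x \<partial>N\<^sub>2) + \<epsilon> * B + K / real n" if n: "n > 0" for n :: nat
  proof -
    define L where "L j = {x \<in> space E. real j \<le> real n * h x / B}" for j :: nat
    have [measurable]: "L j \<in> sets E" for j unfolding L_def by measurable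
    define l where "l x = B / real n * (\<Sum>j\<in>{1..n}. indicator (L j) x)" for x
    have l_bounds: "l x \<le> h x" "h x \<le> l x + B / real n" if x: "x \<in> space E" for x
    proof -
      let ?y = "real n * h x / B"
      have y: "0 \<le> ?y" "?y \<le> real n"
        using bnd[OF x] B n by (auto simp: field_simps)
      have "(\<Sum>j\<in>{1..n}. indicator (L j) x) = (\<Sum>j\<in>{1..n}. (if real j \<le> ?y then 1 else 0 :: real))"
        by (intro sum.cong) (auto simp: L_def x indicator_def)
      with layer_sum_bounds[OF y] have "(\<Sum>j\<in>{1..n}. indicator (L j) x) \<le> ?y"
        "?y \<le> (\<Sum>j\<in>{1..n}. indicator (L j) x) + 1" by simp_all
      then show "l x \<le> h x" "h x \<le> l x + B / real n"
        unfolding l_def using B n by (auto simp: field_simps)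
    qed
    have int_l: "(\<integral>x. l x \<partial>N) = B / real n * (\<Sum>j\<in>{1..n}. measure N (L j))"
      and integrable_l: "integrable N l" and integrable_h: "integrable N h"
      if "finite_measure N" and sN: "sets N = sets E" for N
    proof -
      interpret finite_measure N by fact
      have [measurable_cong]: "sets N = sets E" by fact
      have spN: "space N = space E" using sN sets_eq_imp_space_eq by blast
      have i: "integrable N (indicator (L j) :: _ \<Rightarrow> real)" for j
        by (simp add: sN integrable_indicator_iff emeasure_eq_measure less_top[symmetric])
      show "integrable N l" unfolding l_def using i by auto
      show "(\<integral>x. l x \<partial>N) = B / real n * (\<Sum>j\<in>{1..n}. measure N (L j))"
        unfolding l_def using i by (simp add: sN)
      show "integrable N h"
        by (rule integrable_const_bound[where B=B]) (use bnd spN in \<open>auto intro!: AE_I2\<close>)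
    qed
    note L1 = int_l[OF N(1,3)] integrable_l[OF N(1,3)] integrable_h[OF N(1,3)]
    note L2 = int_l[OF N(2,4)] integrable_l[OF N(2,4)] integrable_h[OF N(2,4)]
    interpret N1: finite_measure N\<^sub>1 by fact
    have "(\<integral>x. h x \<partial>N\<^sub>1) \<le> (\<integral>x. l x + B / real n \<partial>N\<^sub>1)"
      using L1 l_bounds sp by (intro integral_mono) auto
    also have "\<dots> = (\<integral>x. l x \<partial>N\<^sub>1) + B / real n * measure N\<^sub>1 (space E)"
      using L1 sp by simp
    finally have "a * (\<integral>x. h x \<partial>N\<^sub>1) \<le> a * ((\<integral>x. l x \<partial>N\<^sub>1) + B / real n * measure N\<^sub>1 (space E))"
      using \<open>0 \<le> a\<close> by (rule mult_left_mono)
    also have "\<dots> = a * (\<integral>x. l x \<partial>N\<^sub>1) + K / real n"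
      by (simp add: K_def algebra_simps)
    also have "a * (\<integral>x. l x \<partial>N\<^sub>1) = B / real n * (\<Sum>j\<in>{1..n}. a * measure N\<^sub>1 (L j))"
      by (simp add: L1 sum_distrib_left mult_ac)
    also have "\<dots> \<le> B / real n * (\<Sum>j\<in>{1..n}. b * measure N\<^sub>2 (L j) + \<epsilon>)"
      using B le by (intro mult_left_mono sum_mono) auto
    also have "\<dots> = b * (\<integral>x. l x \<partial>N\<^sub>2) + \<epsilon> * B"
      using n by (simp add: L2 sum.distrib sum_distrib_left algebra_simps)
    also have "(\<integral>x. l x \<partial>N\<^sub>2) \<le> (\<integral>x. h x \<partial>N\<^sub>2)"
      using L2 l_bounds sp by (intro integral_mono) auto
    finally show ?thesis using \<open>0 \<le> b\<close> by (simp add: mult_left_mono)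
  qed
  have "(\<lambda>n. b * (\<integral>x. h x \<partial>N\<^sub>2) + \<epsilon> * B + K / real n) \<longlonglongrightarrow> b * (\<integral>x. h x \<partial>N\<^sub>2) + \<epsilon> * B + 0"
    by (intro tendsto_intros lim_const_over_n)
  then show ?thesis
    using step by (intro LIMSEQ_le_const[where a = "a * (\<integral>x. h x \<partial>N\<^sub>1)"]) (auto intro!: exI[of _ 1])
qed

section \<open>Total variation\<close>

text \<open>
  The cells of a partition where \<open>m\<close> is nonnegative, and those where it is negative, each merge into a
  single set. So the total variation is at most twice the largest value of \<open>\<bar>m A\<bar>\<close>.
\<close>

lemma sum_abs_partition_le:
  fixes m :: "'a set \<Rightarrow> real"
  assumes add: "\<And>A B. A \<in> sets E \<Longrightarrow> B \<in> sets E \<Longrightarrow> A \<inter> B = {} \<Longrightarrow> m (A \<union> B) = m A + m B"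
    and bnd: "\<And>A. A \<in> sets E \<Longrightarrow> \<bar>m A\<bar> \<le> K"
    and "finite \<A>" "partition_on (space E) \<A>" "\<A> \<subseteq> sets E"
  shows "(\<Sum>A\<in>\<A>. \<bar>m A\<bar>) \<le> 2 * K"
proof -
  have m0: "m {} = 0" using add[of "{}" "{}"] by simp
  have sum_eq: "(\<Sum>A\<in>\<B>. m A) = m (\<Union>\<B>)" if "\<B> \<subseteq> \<A>" for \<B>
  proof -
    have "finite \<B>" using that assms(3) finite_subset by blast
    then show ?thesis using that
    proof (induction rule: finite_induct)
      case (insert A \<B>)
      have "A \<inter> C = {}" if "C \<in> \<B>" for C
        using insert(2,4) that by (intro disjointD[OF partition_onD2[OF assms(4)]]) auto
      then have "A \<inter> \<Union>\<B> = {}" by blast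
      moreover have "\<Union>\<B> \<in> sets E" "A \<in> sets E"
        using insert assms(5) by (auto intro!: sets.finite_Union)
      ultimately show ?case using insert add[of A "\<Union>\<B>"] by simp
    qed (simp add: m0)
  qed
  let ?P = "{A \<in> \<A>. 0 \<le> m A}" and ?N = "{A \<in> \<A>. m A < 0}"
  have "?P \<union> ?N = \<A>" by auto
  moreover have "(\<Sum>A\<in>?P \<union> ?N. \<bar>m A\<bar>) = (\<Sum>A\<in>?P. \<bar>m A\<bar>) + (\<Sum>A\<in>?N. \<bar>m A\<bar>)"
    using assms(3) by (intro sum.union_disjoint) auto
  ultimately have "(\<Sum>A\<in>\<A>. \<bar>m A\<bar>) = (\<Sum>A\<in>?P. \<bar>m A\<bar>) + (\<Sum>A\<in>?N. \<bar>m A\<bar>)"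
    by simp
  also have "\<dots> = m (\<Union>?P) - m (\<Union>?N)"
    using sum_eq[of ?P] sum_eq[of ?N] by (simp add: sum_negf)
  also have "\<dots> \<le> \<bar>m (\<Union>?P)\<bar> + \<bar>m (\<Union>?N)\<bar>" by linarith
  also have "\<dots> \<le> K + K"
    using assms(3,5) by (intro add_mono bnd sets.finite_Union) auto
  finally show ?thesis by simp
qed

lemma tv_norm_le:
  fixes m :: "'a set \<Rightarrow> real"
  assumes "space E \<noteq> {}"
    and add: "\<And>A B. A \<in> sets E \<Longrightarrow> B \<in> sets E \<Longrightarrow> A \<inter> B = {} \<Longrightarrow> m (A \<union> B) = m A + m B"
    and bnd: "\<And>A. A \<in> sets E \<Longrightarrow> \<bar>m A\<bar> \<le> K"
  shows "tv_norm E m \<le> 2 * K"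
  unfolding tv_norm_def
proof (rule cSup_least)
  have "partition_on (space E) {space E}" using assms(1) by (auto intro: partition_onI)
  then show "{\<Sum>A\<in>\<A>. \<bar>m A\<bar> | \<A>. finite \<A> \<and> partition_on (space E) \<A> \<and> \<A> \<subseteq> sets E} \<noteq> {}"
    by (auto intro!: exI[of _ "{space E}"])
next
  fix z assume "z \<in> {\<Sum>A\<in>\<A>. \<bar>m A\<bar> | \<A>. finite \<A> \<and> partition_on (space E) \<A> \<and> \<A> \<subseteq> sets E}"
  then obtain \<A> where z: "z = (\<Sum>A\<in>\<A>. \<bar>m A\<bar>)" "finite \<A>" "partition_on (space E) \<A>" "\<A> \<subseteq> sets E"
    by blast
  show "z \<le> 2 * K"
    unfolding z(1) by (rule sum_abs_partition_le[OF _ _ z(2-4)]) (fact add bnd)+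
qed

text \<open>
  The partition of the space into \<open>A\<close> and its complement has variation \<open>2 * \<bar>m A\<bar>\<close>, as \<open>m\<close> has total
  mass 0. The two trivial sets are separate because a partition has no empty cell.
\<close>

lemma abs_measure_diff_le_tv_norm:
  assumes \<pi>: "\<pi>\<^sub>1 \<in> space (prob_algebra E)" "\<pi>\<^sub>2 \<in> space (prob_algebra E)" and A: "A \<in> sets E"
  shows "\<bar>measure \<pi>\<^sub>1 A - measure \<pi>\<^sub>2 A\<bar> \<le> tv_norm E (\<lambda>A. measure \<pi>\<^sub>1 A - measure \<pi>\<^sub>2 A) / 2"
proof -
  interpret p1: prob_space \<pi>\<^sub>1 using \<pi> by (simp add: space_prob_algebra)
  interpret p2: prob_space \<pi>\<^sub>2 using \<pi> by (simp add: space_prob_algebra)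
  have s: "sets \<pi>\<^sub>1 = sets E" "sets \<pi>\<^sub>2 = sets E" using \<pi> by (simp_all add: space_prob_algebra)
  then have sp: "space \<pi>\<^sub>1 = space E" "space \<pi>\<^sub>2 = space E" using sets_eq_imp_space_eq by blast+
  let ?m = "\<lambda>A. measure \<pi>\<^sub>1 A - measure \<pi>\<^sub>2 A"
  let ?S = "{\<Sum>A\<in>\<A>. \<bar>?m A\<bar> | \<A>. finite \<A> \<and> partition_on (space E) \<A> \<and> \<A> \<subseteq> sets E}"
  \<comment> \<open>without this bound the supremum that defines the norm would have no meaning\<close>
  have bdd: "bdd_above ?S"
  proof (rule bdd_aboveI)
    fix z assume "z \<in> ?S"
    then obtain \<A> where z: "z = (\<Sum>A\<in>\<A>. \<bar>?m A\<bar>)" "finite \<A>" "partition_on (space E) \<A>" "\<A> \<subseteq> sets E"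
      by blast
    show "z \<le> 2 * 1"
      unfolding z(1)
    proof (rule sum_abs_partition_le[OF _ _ z(2-4)])
      fix A
      have "0 \<le> measure \<pi>\<^sub>1 A" "measure \<pi>\<^sub>1 A \<le> 1" "0 \<le> measure \<pi>\<^sub>2 A" "measure \<pi>\<^sub>2 A \<le> 1" by auto
      then show "\<bar>?m A\<bar> \<le> 1" by linarith
    qed (simp add: s p1.finite_measure_Union p2.finite_measure_Union)
  qed
  have ub: "(\<Sum>A\<in>\<A>. \<bar>?m A\<bar>) \<le> tv_norm E ?m" if "finite \<A>" "partition_on (space E) \<A>" "\<A> \<subseteq> sets E" for \<A>
    unfolding tv_norm_def using that by (intro cSup_upper bdd) blast
  show ?thesis
  proof (cases "A = {} \<or> A = space E")
    case True
    have "space E \<noteq> {}" using p1.not_empty sp by simp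
    then have "0 \<le> tv_norm E ?m"
      using ub[of "{space E}"] sp p1.prob_space p2.prob_space by (simp add: partition_on_def)
    then show ?thesis using True sp p1.prob_space p2.prob_space by auto
  next
    case False
    let ?B = "space E - A"
    have ne: "A \<noteq> ?B" "?B \<noteq> {}" using False sets.sets_into_space[OF A] by auto
    have "partition_on (space E) {A, ?B}"
      using False ne sets.sets_into_space[OF A] by (auto intro!: partition_onI simp: disjnt_def)
    then have "\<bar>?m A\<bar> + \<bar>?m ?B\<bar> \<le> tv_norm E ?m"
      using ub[of "{A, ?B}"] A ne by simp
    moreover have "measure \<pi>\<^sub>1 ?B = 1 - measure \<pi>\<^sub>1 A" "measure \<pi>\<^sub>2 ?B = 1 - measure \<pi>\<^sub>2 A"
      using p1.prob_compl[of A] p2.prob_compl[of A] s sp A by auto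
    ultimately show ?thesis by linarith
  qed
qed

section \<open>Sub-Markov semigroups and their survival ratios\<close>

locale sub_markov_semigroup =
  fixes E :: "'a measure" and Q :: "real \<Rightarrow> 'a \<Rightarrow> 'a measure"
  assumes sets_Q: "0 \<le> t \<Longrightarrow> x \<in> space E \<Longrightarrow> sets (Q t x) = sets E"
    and subprob_space_Q: "0 \<le> t \<Longrightarrow> x \<in> space E \<Longrightarrow> subprob_space (Q t x)"
    and measurable_Q: "0 \<le> t \<Longrightarrow> A \<in> sets E \<Longrightarrow> (\<lambda>x. measure (Q t x) A) \<in> borel_measurable E"
    and Chapman_Kolmogorov: "0 \<le> s \<Longrightarrow> 0 \<le> t \<Longrightarrow> x \<in> space E \<Longrightarrow> A \<in> sets E \<Longrightarrow>
      measure (Q (s + t) x) A = (\<integral>y. measure (Q t y) A \<partial>Q s x)"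
    and survives: "0 \<le> t \<Longrightarrow> x \<in> space E \<Longrightarrow> 0 < measure (Q t x) (space E)"
begin

abbreviation q :: "real \<Rightarrow> 'a set \<Rightarrow> 'a \<Rightarrow> real" where
  "q t A x \<equiv> measure (Q t x) A"

abbreviation surv :: "real \<Rightarrow> 'a \<Rightarrow> real" where
  "surv t \<equiv> q t (space E)"

definition mass :: "'a measure \<Rightarrow> real \<Rightarrow> 'a set \<Rightarrow> real" where
  "mass \<pi> t A = (\<integral>x. q t A x \<partial>\<pi>)"

text \<open>
  Bounds on the ratio \<open>q T A x / surv T x\<close> that hold for all starting points. Multiplied out, they
  can be integrated against any measure.
\<close>

definition ratio_band :: "real \<Rightarrow> 'a set \<Rightarrow> real \<Rightarrow> real \<Rightarrow> bool" where
  "ratio_band T A lo hi \<longleftrightarrow>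
     (\<forall>x\<in>space E. lo * surv T x \<le> q T A x \<and> q T A x \<le> hi * surv T x)"

lemma finite_measure_Q: "0 \<le> t \<Longrightarrow> x \<in> space E \<Longrightarrow> finite_measure (Q t x)"
  using subprob_space_Q subprob_space_def by blast

lemma space_Q: "0 \<le> t \<Longrightarrow> x \<in> space E \<Longrightarrow> space (Q t x) = space E"
  using sets_Q sets_eq_imp_space_eq by blast

lemma q_le_1: "0 \<le> t \<Longrightarrow> x \<in> space E \<Longrightarrow> q t A x \<le> 1"
  by (rule subprob_space.subprob_measure_le_1[OF subprob_space_Q])

lemma q_le_surv: "0 \<le> t \<Longrightarrow> x \<in> space E \<Longrightarrow> A \<in> sets E \<Longrightarrow> q t A x \<le> surv t x"
  by (metis finite_measure.bounded_measure finite_measure_Q space_Q)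

lemma integrable_bounded_on:
  fixes h :: "'a \<Rightarrow> real"
  assumes "finite_measure N" "sets N = sets E" "h \<in> borel_measurable E"
    and "\<And>x. x \<in> space E \<Longrightarrow> \<bar>h x\<bar> \<le> B"
  shows "integrable N h"
proof -
  interpret finite_measure N by fact
  have "space N = space E" using assms(2) sets_eq_imp_space_eq by blast
  moreover have "h \<in> borel_measurable N" using assms(2,3) measurable_cong_sets by blast
  ultimately show ?thesis
    using assms(4) by (intro integrable_const_bound[where B = B]) (auto intro!: AE_I2)
qed

lemma integrable_q:
  "finite_measure N \<Longrightarrow> sets N = sets E \<Longrightarrow> 0 \<le> t \<Longrightarrow> A \<in> sets E \<Longrightarrow> integrable N (q t A)"
  by (rule integrable_bounded_on[where B = 1]) (auto intro: measurable_Q q_le_1)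

lemma mass_add:
  assumes "finite_measure N" "sets N = sets E" "0 \<le> t" "A \<in> sets E" "B \<in> sets E" "A \<inter> B = {}"
  shows "mass N t (A \<union> B) = mass N t A + mass N t B"
proof -
  have "mass N t (A \<union> B) = (\<integral>x. q t A x + q t B x \<partial>N)"
    unfolding mass_def
  proof (rule Bochner_Integration.integral_cong)
    fix x assume "x \<in> space N"
    then have x: "x \<in> space E" using assms(2) sets_eq_imp_space_eq by blast
    interpret finite_measure "Q t x" by (rule finite_measure_Q) fact+
    show "q t (A \<union> B) x = q t A x + q t B x"
      using assms sets_Q[OF assms(3) x] by (intro finite_measure_Union) auto
  qed simp
  then show ?thesis unfolding mass_def using assms by (simp add: integrable_q)
qed

lemma mass_nonneg: "0 \<le> mass \<pi> t A"
  unfolding mass_def by (rule Bochner_Integration.integral_nonneg) simp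

lemma integral_pos:
  fixes h :: "'a \<Rightarrow> real"
  assumes "\<pi> \<in> space (prob_algebra E)" "h \<in> borel_measurable E"
    and "\<And>x. x \<in> space E \<Longrightarrow> 0 < h x \<and> h x \<le> B"
  shows "0 < (\<integral>x. h x \<partial>\<pi>)"
proof -
  interpret prob_space \<pi> using assms(1) by (simp add: space_prob_algebra)
  have s: "sets \<pi> = sets E" using assms(1) by (simp add: space_prob_algebra)
  then have sp: "space \<pi> = space E" by (rule sets_eq_imp_space_eq)
  have int: "integrable \<pi> h"
    by (rule integrable_bounded_on[where B = B]) (use assms s finite_measure_axioms in force)+
  have ae: "AE x in \<pi>. 0 \<le> h x" using assms(3) sp by (force intro!: AE_I2)
  have "(\<integral>x. h x \<partial>\<pi>) \<noteq> 0"
  proof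
    assume "(\<integral>x. h x \<partial>\<pi>) = 0"
    then have "AE x in \<pi>. h x = 0" using integral_nonneg_eq_0_iff_AE[OF int ae] by simp
    moreover have "AE x in \<pi>. h x \<noteq> 0" using assms(3) sp by (force intro!: AE_I2)
    ultimately have "AE x in \<pi>. False" by eventually_elim simp
    then show False by simp
  qed
  moreover have "0 \<le> (\<integral>x. h x \<partial>\<pi>)" using integral_nonneg_AE[OF ae] .
  ultimately show ?thesis by simp
qed

lemma mass_space_pos:
  "\<pi> \<in> space (prob_algebra E) \<Longrightarrow> 0 \<le> t \<Longrightarrow> 0 < mass \<pi> t (space E)"
  unfolding mass_def
  by (rule integral_pos[where B = 1]) (auto intro: survives q_le_1 measurable_Q)

text \<open>
  An initial distribution conditions to a weighted average of the ratios at single points, so the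
  bounds carry over.
\<close>

lemma mass_in_band:
  assumes N: "finite_measure N" "sets N = sets E" and "0 \<le> T" "A \<in> sets E"
    and band: "ratio_band T A lo hi"
  shows "lo * mass N T (space E) \<le> mass N T A" "mass N T A \<le> hi * mass N T (space E)"
proof -
  have sp: "space N = space E" using N(2) by (rule sets_eq_imp_space_eq)
  have "(\<integral>x. lo * surv T x \<partial>N) \<le> (\<integral>x. q T A x \<partial>N)" "(\<integral>x. q T A x \<partial>N) \<le> (\<integral>x. hi * surv T x \<partial>N)"
    using band sp assms
    by (intro integral_mono integrable_mult_right integrable_q; simp add: ratio_band_def)+
  then show "lo * mass N T (space E) \<le> mass N T A" "mass N T A \<le> hi * mass N T (space E)"
    by (simp_all add: mass_def)
qed

lemma q_eq_mass:
  "0 \<le> s \<Longrightarrow> 0 \<le> t \<Longrightarrow> x \<in> space E \<Longrightarrow> A \<in> sets E \<Longrightarrow> q (s + t) A x = mass (Q s x) t A"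
  by (simp add: mass_def Chapman_Kolmogorov)

text \<open>
  The ratio at a later time \<open>s + T\<close> is the one at time \<open>T\<close> for the initial law \<open>Q s x\<close>.
\<close>

lemma ratio_band_later:
  assumes "0 \<le> s" "0 \<le> T" "A \<in> sets E" "ratio_band T A lo hi"
  shows "ratio_band (s + T) A lo hi"
  using mass_in_band[OF finite_measure_Q sets_Q] assms
  by (simp add: ratio_band_def[of "s + T"] q_eq_mass)

lemma ratio_band_mono:
  assumes "0 \<le> T" "ratio_band T A lo hi" "lo' \<le> lo" "hi \<le> hi'"
  shows "ratio_band T A lo' hi'"
proof -
  have "lo' * surv T x \<le> lo * surv T x" "hi * surv T x \<le> hi' * surv T x" for x
    using assms by (auto intro: mult_right_mono)
  then show ?thesis using assms(2) unfolding ratio_band_def by (meson order_trans)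
qed

lemma surv_antimono:
  assumes "0 \<le> s" "s \<le> t" "x \<in> space E"
  shows "surv t x \<le> surv s x"
proof -
  interpret finite_measure "Q s x" by (rule finite_measure_Q) fact+
  have "surv t x = (\<integral>y. surv (t - s) y \<partial>Q s x)"
    using Chapman_Kolmogorov[of s "t - s" x "space E"] assms by simp
  also have "\<dots> \<le> (\<integral>y. 1 \<partial>Q s x)"
    using assms sets_Q[of s x] space_Q[of s x]
    by (intro integral_mono integrable_q finite_measure_axioms) (auto intro: q_le_1)
  finally show ?thesis using space_Q assms by simp
qed

end

section \<open>Contraction under two-sided bounds\<close>

locale two_sided_semigroup = sub_markov_semigroup E Q
  for E :: "'a measure" and Q :: "real \<Rightarrow> 'a \<Rightarrow> 'a measure" +
  fixes t\<^sub>0 c :: real and \<mu> :: "'a measure" and f :: "'a \<Rightarrow> real"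
  assumes t0_pos: "0 < t\<^sub>0" and c_pos: "0 < c"
    and mu: "\<mu> \<in> space (prob_algebra E)"
    and measurable_f: "f \<in> borel_measurable E"
    and f_pos: "x \<in> space E \<Longrightarrow> 0 < f x"
    and two_sided: "x \<in> space E \<Longrightarrow> A \<in> sets E \<Longrightarrow>
      1 / c * f x * measure \<mu> A \<le> measure (Q t\<^sub>0 x) A \<and> measure (Q t\<^sub>0 x) A \<le> c * f x * measure \<mu> A"
begin

lemma prob_mu: "prob_space \<mu>" and sets_mu: "sets \<mu> = sets E"
  using mu by (simp_all add: space_prob_algebra)

lemma space_mu: "space \<mu> = space E"
  using sets_mu by (rule sets_eq_imp_space_eq)

lemma finite_mu: "finite_measure \<mu>"
  using prob_mu by (simp add: prob_space_def)

lemma space_nonempty: "space E \<noteq> {}"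
  using prob_space.not_empty[OF prob_mu] space_mu by simp

lemma mu_space: "measure \<mu> (space E) = 1"
  using prob_space.prob_space[OF prob_mu] space_mu by simp

lemma c_ge_1: "1 \<le> c"
proof -
  obtain x where x: "x \<in> space E" using space_nonempty by blast
  have "1 / c * f x \<le> c * f x"
    using two_sided[OF x sets.top] mu_space by simp
  then have "1 / c \<le> c" by (rule mult_right_le_imp_le) (rule f_pos[OF x])
  then have "1 \<le> c\<^sup>2" using c_pos by (simp add: field_simps power2_eq_square)
  then show ?thesis using c_pos power2_le_imp_le[of 1 c] by simp
qed

lemma f_le_c:
  assumes x: "x \<in> space E"
  shows "f x \<le> c"
proof -
  have "f x \<le> c * surv t\<^sub>0 x"
    using two_sided[OF x sets.top] mu_space c_pos by (simp add: field_simps)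
  also have "\<dots> \<le> c * 1"
    using q_le_1[of t\<^sub>0 x] t0_pos c_pos x by (intro mult_left_mono) auto
  finally show ?thesis by simp
qed

lemma integrable_f: "finite_measure N \<Longrightarrow> sets N = sets E \<Longrightarrow> integrable N f"
  using measurable_f f_pos f_le_c by (intro integrable_bounded_on[where B = c]) force+

lemma integral_f_pos: "\<pi> \<in> space (prob_algebra E) \<Longrightarrow> 0 < (\<integral>x. f x \<partial>\<pi>)"
  using measurable_f f_pos f_le_c by (intro integral_pos[where B = c]) auto

lemma integral_f_le_c:
  assumes "\<pi> \<in> space (prob_algebra E)"
  shows "(\<integral>x. f x \<partial>\<pi>) \<le> c"
proof -
  interpret prob_space \<pi> using assms by (simp add: space_prob_algebra)
  have s: "sets \<pi> = sets E" using assms by (simp add: space_prob_algebra)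
  have "(\<integral>x. f x \<partial>\<pi>) \<le> (\<integral>x. c \<partial>\<pi>)"
    using s sets_eq_imp_space_eq[OF s] f_le_c
    by (intro integral_mono integrable_f finite_measure_axioms) auto
  then show ?thesis by (simp add: prob_space)
qed

lemma integral_Q_bounds:
  fixes h :: "'a \<Rightarrow> real"
  assumes x: "x \<in> space E" and h: "h \<in> borel_measurable E" "0 \<le> B"
    and bnd: "\<And>y. y \<in> space E \<Longrightarrow> 0 \<le> h y \<and> h y \<le> B"
  shows "1 / c * f x * (\<integral>y. h y \<partial>\<mu>) \<le> (\<integral>y. h y \<partial>Q t\<^sub>0 x)"
    and "(\<integral>y. h y \<partial>Q t\<^sub>0 x) \<le> c * f x * (\<integral>y. h y \<partial>\<mu>)"
proof -
  have fin: "finite_measure (Q t\<^sub>0 x)" "sets (Q t\<^sub>0 x) = sets E"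
    using t0_pos x finite_measure_Q sets_Q by auto
  have fx: "0 \<le> f x" using f_pos[OF x] by simp
  show "1 / c * f x * (\<integral>y. h y \<partial>\<mu>) \<le> (\<integral>y. h y \<partial>Q t\<^sub>0 x)"
    using integral_le_of_measure_le[OF finite_mu fin(1) sets_mu fin(2), of "1 / c * f x" 1 B 0 h]
      two_sided[OF x] c_pos fx h bnd by simp
  show "(\<integral>y. h y \<partial>Q t\<^sub>0 x) \<le> c * f x * (\<integral>y. h y \<partial>\<mu>)"
    using integral_le_of_measure_le[OF fin(1) finite_mu fin(2) sets_mu, of 1 "c * f x" B 0 h]
      two_sided[OF x] c_pos fx h bnd by simp
qed

text \<open>
  The subtracted \<open>1 / c\<^sup>2\<close> is the quotient of the factors \<open>1 / c\<close> and \<open>c\<close> in the two bounds on \<open>Q t\<^sub>0 x\<close>.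
\<close>

definition rate :: real where
  "rate = 1 - 1 / c\<^sup>2"

lemma rate_nonneg: "0 \<le> rate" and rate_less_1: "rate < 1"
  using c_ge_1 by (simp_all add: rate_def field_simps)

lemma rate_le: "rate \<le> 1 - 1 / c ^ 5 * (\<integral>x. f x \<partial>\<mu>)"
proof -
  have "1 / c ^ 5 * (\<integral>x. f x \<partial>\<mu>) \<le> 1 / c ^ 5 * c"
    using integral_f_le_c[OF mu] c_pos by (intro mult_left_mono) auto
  also have "\<dots> = 1 / c ^ 4" using c_pos by (simp add: field_simps eval_nat_numeral)
  also have "\<dots> \<le> 1 / c\<^sup>2"
    using c_ge_1 by (intro divide_left_mono power_increasing) auto
  finally show ?thesis by (simp add: rate_def)
qed

text \<open>
  Let \<open>a\<close> be the average of the ratios at time \<open>T\<close> for the initial law \<open>\<mu>\<close>, so that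
  \<open>\<mu>(q T A - lo * surv T) = (a - lo) * \<mu>(surv T)\<close>. The lower bound on \<open>Q t\<^sub>0 x\<close>, applied to the nonnegative
  function \<open>q T A - lo * surv T\<close>, and the upper bound, applied to \<open>surv T\<close>, both contain the factor
  \<open>f x\<close>; dividing them shows that the ratio at time \<open>t\<^sub>0 + T\<close> exceeds \<open>lo\<close> by at least
  \<open>(a - lo) / c\<^sup>2\<close>. Symmetrically it stays below \<open>hi\<close> by at least \<open>(hi - a) / c\<^sup>2\<close>, and the two gains add up
  to \<open>(hi - lo) / c\<^sup>2\<close>.
\<close>

lemma ratio_band_contract:
  assumes "0 \<le> T" "A \<in> sets E" and band: "ratio_band T A lo hi"
  obtains lo' hi' where "hi' - lo' = rate * (hi - lo)" "ratio_band (t\<^sub>0 + T) A lo' hi'"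
proof -
  define s where "s = mass \<mu> T (space E)"
  define a where "a = mass \<mu> T A / s"
  have s: "0 < s" unfolding s_def using mu assms(1) by (rule mass_space_pos)
  have as: "mass \<mu> T A = a * s" using s by (simp add: a_def)
  have a: "lo \<le> a" "a \<le> hi"
    using mass_in_band[OF finite_mu sets_mu assms] s by (simp_all add: a_def s_def field_simps)
  have int: "integrable N (q T A)" "integrable N (surv T)"
    if "finite_measure N" "sets N = sets E" for N
    using integrable_q[OF that assms(1)] assms(2) by auto
  note int_mu = int[OF finite_mu sets_mu]
  have meas [measurable]: "q T A \<in> borel_measurable E" "surv T \<in> borel_measurable E"
    using measurable_Q assms(1,2) by auto
  have step: "1 / c\<^sup>2 * z * surv (t\<^sub>0 + T) x \<le> (\<integral>y. h y \<partial>Q t\<^sub>0 x)"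
    if x: "x \<in> space E" and "0 \<le> z" and hm: "h \<in> borel_measurable E"
      and hb: "\<And>y. y \<in> space E \<Longrightarrow> 0 \<le> h y \<and> h y \<le> B" and hz: "(\<integral>y. h y \<partial>\<mu>) = z * s"
    for x z h B
  proof -
    have "0 \<le> B" using hb[OF x] by linarith
    have "surv (t\<^sub>0 + T) x \<le> c * f x * s"
      using integral_Q_bounds(2)[OF x meas(2), of 1] q_le_1[OF assms(1)] Chapman_Kolmogorov[of t\<^sub>0 T x "space E"]
        t0_pos assms(1) x by (simp add: s_def mass_def)
    then have "1 / c\<^sup>2 * z * surv (t\<^sub>0 + T) x \<le> 1 / c\<^sup>2 * z * (c * f x * s)"
      using \<open>0 \<le> z\<close> by (intro mult_left_mono) auto
    also have "\<dots> = 1 / c * f x * (z * s)" using c_pos by (simp add: field_simps power2_eq_square)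
    also have "\<dots> \<le> (\<integral>y. h y \<partial>Q t\<^sub>0 x)"
      using integral_Q_bounds(1)[OF x hm \<open>0 \<le> B\<close> hb] by (simp add: hz)
    finally show ?thesis .
  qed
  have "ratio_band (t\<^sub>0 + T) A (lo + 1 / c\<^sup>2 * (a - lo)) (hi - 1 / c\<^sup>2 * (hi - a))"
    unfolding ratio_band_def
  proof (intro ballI conjI)
    fix x assume x: "x \<in> space E"
    have fin: "finite_measure (Q t\<^sub>0 x)" "sets (Q t\<^sub>0 x) = sets E"
      using t0_pos x finite_measure_Q sets_Q by auto
    note int_Q = int[OF fin]
    have ck: "q (t\<^sub>0 + T) A x = (\<integral>y. q T A y \<partial>Q t\<^sub>0 x)" "surv (t\<^sub>0 + T) x = (\<integral>y. surv T y \<partial>Q t\<^sub>0 x)"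
      using Chapman_Kolmogorov t0_pos assms(1,2) x by auto
    have b: "lo * surv T y \<le> q T A y" "q T A y \<le> hi * surv T y" "q T A y \<le> 1" "0 \<le> q T A y"
      if "y \<in> space E" for y
      using band that q_le_1[OF assms(1) that] by (auto simp: ratio_band_def)
    have bz: "\<bar>z * surv T y\<bar> \<le> \<bar>z\<bar>" if "y \<in> space E" for y z
      using q_le_1[OF assms(1) that] by (auto simp: abs_mult mult_left_le)
    have "1 / c\<^sup>2 * (a - lo) * surv (t\<^sub>0 + T) x \<le> (\<integral>y. q T A y - lo * surv T y \<partial>Q t\<^sub>0 x)"
    proof (rule step[OF x, where B = "1 + \<bar>lo\<bar>"])
      fix y assume "y \<in> space E"
      then show "0 \<le> q T A y - lo * surv T y \<and> q T A y - lo * surv T y \<le> 1 + \<bar>lo\<bar>"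
        using b[of y] bz[of y lo] by linarith
    qed (use a in \<open>auto simp: int_mu as[unfolded mass_def] s_def[unfolded mass_def, symmetric] algebra_simps\<close>)
    then show "(lo + 1 / c\<^sup>2 * (a - lo)) * surv (t\<^sub>0 + T) x \<le> q (t\<^sub>0 + T) A x"
      by (simp add: int_Q distrib_right left_diff_distrib flip: ck)
    have "1 / c\<^sup>2 * (hi - a) * surv (t\<^sub>0 + T) x \<le> (\<integral>y. hi * surv T y - q T A y \<partial>Q t\<^sub>0 x)"
    proof (rule step[OF x, where B = "\<bar>hi\<bar>"])
      fix y assume "y \<in> space E"
      then show "0 \<le> hi * surv T y - q T A y \<and> hi * surv T y - q T A y \<le> \<bar>hi\<bar>"
        using b[of y] bz[of y hi] by linarith
    qed (use a in \<open>auto simp: int_mu as[unfolded mass_def] s_def[unfolded mass_def, symmetric] algebra_simps\<close>)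
    then show "q (t\<^sub>0 + T) A x \<le> (hi - 1 / c\<^sup>2 * (hi - a)) * surv (t\<^sub>0 + T) x"
      by (simp add: int_Q distrib_right left_diff_distrib flip: ck)
  qed
  moreover have "hi - 1 / c\<^sup>2 * (hi - a) - (lo + 1 / c\<^sup>2 * (a - lo)) = rate * (hi - lo)"
    by (simp add: rate_def algebra_simps diff_divide_distrib)
  ultimately show ?thesis using that by blast
qed

lemma ratio_band_rate:
  assumes "0 \<le> r" "A \<in> sets E"
  shows "\<exists>lo. ratio_band (real n * t\<^sub>0 + r) A lo (lo + rate ^ n)"
proof (induction n)
  case 0
  have "ratio_band r A 0 1"
    using assms q_le_surv by (auto simp: ratio_band_def)
  then show ?case by (auto intro!: exI[of _ 0])
next
  case (Suc n)
  then obtain lo where lo: "ratio_band (real n * t\<^sub>0 + r) A lo (lo + rate ^ n)" by blast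
  obtain lo' hi' where "hi' - lo' = rate * (lo + rate ^ n - lo)"
    "ratio_band (t\<^sub>0 + (real n * t\<^sub>0 + r)) A lo' hi'"
    using assms t0_pos by (rule_tac ratio_band_contract[OF _ assms(2) lo]) auto
  then have "ratio_band (real (Suc n) * t\<^sub>0 + r) A lo' (lo' + rate ^ Suc n)"
    by (simp add: algebra_simps diff_eq_eq)
  then show ?case by blast
qed

text \<open>
  For \<open>t \<ge> t\<^sub>0\<close> both sides are compared with \<open>m = \<mu>(surv (t - t\<^sub>0))\<close>: the upper bound and \<open>f \<le> c\<close> give
  \<open>surv t z \<le> c\<^sup>2 m\<close>, the lower bound gives \<open>\<pi>(surv t) \<ge> \<pi>(f) m / c\<close>. For \<open>t < t\<^sub>0\<close> survival up to
  \<open>t\<^sub>0\<close>, which has probability at least \<open>f x / c\<close>, is enough.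
\<close>

lemma surv_le_mass:
  assumes \<pi>: "\<pi> \<in> space (prob_algebra E)" and "0 \<le> t" and z: "z \<in> space E"
  shows "surv t z * (\<integral>x. f x \<partial>\<pi>) \<le> c ^ 3 * mass \<pi> t (space E)"
proof -
  have fin: "finite_measure \<pi>" "sets \<pi> = sets E"
    using \<pi> by (simp_all add: space_prob_algebra prob_space_def)
  have sp: "space \<pi> = space E" using fin(2) by (rule sets_eq_imp_space_eq)
  have F: "0 < (\<integral>x. f x \<partial>\<pi>)" using \<pi> by (rule integral_f_pos)
  have c3: "c \<le> c ^ 3" using power_increasing[of 1 3 c] c_ge_1 by simp
  show ?thesis
  proof (cases "t\<^sub>0 \<le> t")
    case True
    define T where "T = t - t\<^sub>0"
    define m where "m = mass \<mu> T (space E)"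
    have T: "0 \<le> T" "t = t\<^sub>0 + T" using True by (auto simp: T_def)
    have m: "0 \<le> m" unfolding m_def by (rule mass_nonneg)
    have meas: "surv T \<in> borel_measurable E" using T by (intro measurable_Q) auto
    have bnds: "1 / c * f x * m \<le> surv t x" "surv t x \<le> c * f x * m" if x: "x \<in> space E" for x
      using integral_Q_bounds[OF x meas, of 1] q_le_1[OF T(1)] Chapman_Kolmogorov[of t\<^sub>0 T x "space E"]
        t0_pos T x by (simp_all add: m_def mass_def)
    have "surv t z \<le> c * f z * m" using bnds z by blast
    also have "\<dots> \<le> c * c * m"
      using f_le_c[OF z] c_pos m by (intro mult_right_mono mult_left_mono) auto
    finally have "surv t z * (\<integral>x. f x \<partial>\<pi>) \<le> c * c * m * (\<integral>x. f x \<partial>\<pi>)"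
      using F by (intro mult_right_mono) auto
    also have "\<dots> = c ^ 3 * (1 / c * m * (\<integral>x. f x \<partial>\<pi>))"
      using c_pos by (simp add: field_simps eval_nat_numeral)
    also have "1 / c * m * (\<integral>x. f x \<partial>\<pi>) = (\<integral>x. 1 / c * m * f x \<partial>\<pi>)" by simp
    also have "\<dots> \<le> mass \<pi> t (space E)"
      unfolding mass_def using bnds(1) sp fin assms(2)
      by (intro integral_mono integrable_mult_right integrable_f integrable_q) (auto simp: mult_ac)
    finally show ?thesis using c_pos by simp
  next
    case False
    have "(\<integral>x. f x \<partial>\<pi>) = c * (\<integral>x. 1 / c * f x \<partial>\<pi>)" using c_pos by simp
    also have "(\<integral>x. 1 / c * f x \<partial>\<pi>) \<le> mass \<pi> t (space E)"
      unfolding mass_def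
    proof (intro integral_mono integrable_mult_right integrable_f integrable_q fin assms sets.top)
      fix x assume "x \<in> space \<pi>"
      then have x: "x \<in> space E" using sp by simp
      have "1 / c * f x \<le> surv t\<^sub>0 x" using two_sided[OF x sets.top] mu_space by simp
      also have "\<dots> \<le> surv t x" using False assms(2) x by (intro surv_antimono) auto
      finally show "1 / c * f x \<le> surv t x" .
    qed
    finally have "(\<integral>x. f x \<partial>\<pi>) \<le> c * mass \<pi> t (space E)" using c_pos by simp
    also have "\<dots> \<le> c ^ 3 * mass \<pi> t (space E)"
      using c3 mass_nonneg by (rule mult_right_mono)
    finally have "(\<integral>x. f x \<partial>\<pi>) \<le> c ^ 3 * mass \<pi> t (space E)" .
    moreover have "surv t z * (\<integral>x. f x \<partial>\<pi>) \<le> 1 * (\<integral>x. f x \<partial>\<pi>)"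
      using q_le_1[OF assms(2) z] F by (intro mult_right_mono) auto
    ultimately show ?thesis by simp
  qed
qed

text \<open>
  The choice of \<open>\<theta>\<close> as the value for \<open>\<pi>'\<close> leaves only the denominator for \<open>\<pi>\<close>, so exchanging the two
  laws puts the larger of \<open>\<pi>(f)\<close> and \<open>\<pi>'(f)\<close> into the bound.
\<close>

lemma conditional_difference_le:
  assumes \<pi>: "\<pi> \<in> space (prob_algebra E)" "\<pi>' \<in> space (prob_algebra E)" and t: "0 \<le> t" "A \<in> sets E"
    and close: "\<And>A. A \<in> sets E \<Longrightarrow> measure \<pi> A \<le> measure \<pi>' A + D"
      "\<And>A. A \<in> sets E \<Longrightarrow> measure \<pi>' A \<le> measure \<pi> A + D"
  shows "\<bar>mass \<pi> t A / mass \<pi> t (space E) - mass \<pi>' t A / mass \<pi>' t (space E)\<bar>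
    \<le> c ^ 3 * (rate ^ nat \<lfloor>t / t\<^sub>0\<rfloor> / (\<integral>x. f x \<partial>\<pi>)) * D"
proof -
  interpret p1: prob_space \<pi> using \<pi> by (simp add: space_prob_algebra)
  interpret p2: prob_space \<pi>' using \<pi> by (simp add: space_prob_algebra)
  have s: "sets \<pi> = sets E" "sets \<pi>' = sets E" using \<pi> by (simp_all add: space_prob_algebra)
  have D: "0 \<le> D" using close(1)[of "{}"] by simp
  define k where "k = nat \<lfloor>t / t\<^sub>0\<rfloor>"
  define r where "r = t - real k * t\<^sub>0"
  have "real k \<le> t / t\<^sub>0" unfolding k_def using t(1) t0_pos by (simp add: zero_le_divide_iff)
  then have r: "0 \<le> r" "t = real k * t\<^sub>0 + r" using t0_pos by (simp_all add: r_def field_simps)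
  define w where "w = rate ^ k"
  have w: "0 \<le> w" unfolding w_def using rate_nonneg by simp
  obtain lo where band: "ratio_band t A lo (lo + w)"
    using ratio_band_rate[OF r(1) t(2), of k] r(2) by (auto simp: w_def)
  define S where "S = c ^ 3 * mass \<pi> t (space E) / (\<integral>x. f x \<partial>\<pi>)"
  have F: "0 < (\<integral>x. f x \<partial>\<pi>)" using \<pi>(1) by (rule integral_f_pos)
  have m: "0 < mass \<pi> t (space E)" "0 < mass \<pi>' t (space E)" using \<pi> t mass_space_pos by auto
  have S: "0 \<le> S" unfolding S_def using F m c_pos by simp
  have surv_S: "surv t x \<le> S" if "x \<in> space E" for x
    using surv_le_mass[OF \<pi>(1) t(1) that] F by (simp add: S_def pos_le_divide_eq)
  define \<theta> where "\<theta> = mass \<pi>' t A / mass \<pi>' t (space E)"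
  have \<theta>: "lo \<le> \<theta>" "\<theta> \<le> lo + w"
    using mass_in_band[OF p2.finite_measure_axioms s(2) t band] m by (simp_all add: \<theta>_def field_simps)
  \<comment> \<open>the constant shifts the function into \<open>[0, S * w]\<close>; it cancels because both laws have mass 1\<close>
  define h where "h x = q t A x - \<theta> * surv t x + S * (\<theta> - lo)" for x
  have meas: "q t A \<in> borel_measurable E" "surv t \<in> borel_measurable E"
    using measurable_Q t by auto
  have h_meas: "h \<in> borel_measurable E" unfolding h_def using meas by measurable
  have h: "0 \<le> h x \<and> h x \<le> S * w" if x: "x \<in> space E" for x
  proof -
    have "lo * surv t x \<le> q t A x" "q t A x \<le> (lo + w) * surv t x"
      using band x by (auto simp: ratio_band_def)
    moreover have "(\<theta> - lo) * surv t x \<le> (\<theta> - lo) * S" "(lo + w - \<theta>) * surv t x \<le> (lo + w - \<theta>) * S"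
      using surv_S[OF x] \<theta> by (auto intro!: mult_left_mono)
    ultimately show ?thesis by (simp add: h_def algebra_simps)
  qed
  have int: "(\<integral>x. h x \<partial>N) = mass N t A - \<theta> * mass N t (space E) + S * (\<theta> - lo)"
    if "prob_space N" "sets N = sets E" for N
  proof -
    interpret prob_space N by fact
    show ?thesis
      using integrable_q[OF finite_measure_axioms that(2) t(1)] t(2)
      by (simp add: h_def mass_def prob_space)
  qed
  have i1: "(\<integral>x. h x \<partial>\<pi>) = mass \<pi> t A - \<theta> * mass \<pi> t (space E) + S * (\<theta> - lo)"
    using int p1.prob_space_axioms s(1) by blast
  have i2: "(\<integral>x. h x \<partial>\<pi>') = S * (\<theta> - lo)"
    using int[OF p2.prob_space_axioms s(2)] m by (simp add: \<theta>_def)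
  have Sw: "0 \<le> S * w" using S w by simp
  have "(\<integral>x. h x \<partial>\<pi>) \<le> (\<integral>x. h x \<partial>\<pi>') + D * (S * w)"
    using integral_le_of_measure_le[of \<pi> \<pi>' E 1 1 "S * w" D h] Sw close h h_meas s
      p1.finite_measure_axioms p2.finite_measure_axioms by simp
  moreover have "(\<integral>x. h x \<partial>\<pi>') \<le> (\<integral>x. h x \<partial>\<pi>) + D * (S * w)"
    using integral_le_of_measure_le[of \<pi>' \<pi> E 1 1 "S * w" D h] Sw close h h_meas s
      p1.finite_measure_axioms p2.finite_measure_axioms by simp
  ultimately have "\<bar>mass \<pi> t A - \<theta> * mass \<pi> t (space E)\<bar> \<le> D * (S * w)"
    unfolding i1 i2 by linarith
  then have "\<bar>mass \<pi> t A - \<theta> * mass \<pi> t (space E)\<bar> / mass \<pi> t (space E) \<le> D * (S * w) / mass \<pi> t (space E)"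
    using m by (intro divide_right_mono) auto
  also have "\<bar>mass \<pi> t A - \<theta> * mass \<pi> t (space E)\<bar> / mass \<pi> t (space E) = \<bar>mass \<pi> t A / mass \<pi> t (space E) - \<theta>\<bar>"
    using m by (simp add: field_simps flip: abs_div_pos)
  also have "D * (S * w) / mass \<pi> t (space E) = c ^ 3 * (w / (\<integral>x. f x \<partial>\<pi>)) * D"
    using m by (simp add: S_def field_simps)
  finally show ?thesis by (simp add: \<theta>_def w_def k_def)
qed

section \<open>The quasi-stationary distribution as the limit of survival ratios\<close>

text \<open>
  The bands at the times \<open>n * t\<^sub>0\<close> contain all later ratios and shrink geometrically, so the ratios form
  a Cauchy sequence, and the limit is within \<open>rate ^ n\<close> of the whole band.
\<close>

lemma limit_value_exists:
  assumes A: "A \<in> sets E"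
  shows "\<exists>L. \<forall>n. ratio_band (real n * t\<^sub>0) A (L - rate ^ n) (L + rate ^ n)"
proof -
  obtain x where x: "x \<in> space E" using space_nonempty by blast
  define g where "g n = q (real n * t\<^sub>0) A x / surv (real n * t\<^sub>0) x" for n
  have g_band: "lo \<le> g n \<and> g n \<le> hi" if "ratio_band (real n * t\<^sub>0) A lo hi" for n lo hi
    using that x survives[of "real n * t\<^sub>0" x] t0_pos
    by (simp add: g_def ratio_band_def pos_le_divide_eq pos_divide_le_eq)
  have "\<exists>lo. ratio_band (real n * t\<^sub>0) A lo (lo + rate ^ n)" for n
    using ratio_band_rate[of 0 A n] A by simp
  then obtain lo where lo: "\<And>n. ratio_band (real n * t\<^sub>0) A (lo n) (lo n + rate ^ n)" by metis
  have later: "lo n \<le> g m \<and> g m \<le> lo n + rate ^ n" if "n \<le> m" for n m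
  proof (rule g_band)
    have "real m * t\<^sub>0 = real (m - n) * t\<^sub>0 + real n * t\<^sub>0" using that by (simp add: of_nat_diff algebra_simps)
    then show "ratio_band (real m * t\<^sub>0) A (lo n) (lo n + rate ^ n)"
      using ratio_band_later[OF _ _ A lo, of "real (m - n) * t\<^sub>0" n] t0_pos by simp
  qed
  have "Cauchy g"
  proof (rule CauchyI)
    fix e :: real assume "0 < e"
    then obtain N where N: "rate ^ N < e" using real_arch_pow_inv rate_less_1 by blast
    have "norm (g m - g n) < e" if "N \<le> m" "N \<le> n" for m n
      using later[OF that(1)] later[OF that(2)] N by (simp add: abs_if)
    then show "\<exists>N. \<forall>m\<ge>N. \<forall>n\<ge>N. norm (g m - g n) < e" by blast
  qed
  then obtain L where L: "g \<longlonglongrightarrow> L" using Cauchy_convergent_iff convergent_def by blast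
  have "ratio_band (real n * t\<^sub>0) A (L - rate ^ n) (L + rate ^ n)" for n
  proof (rule ratio_band_mono[OF _ lo])
    have "lo n \<le> L" "L \<le> lo n + rate ^ n"
      using later by (auto intro!: LIMSEQ_le_const[OF L] LIMSEQ_le_const2[OF L])
    then show "L - rate ^ n \<le> lo n" "lo n + rate ^ n \<le> L + rate ^ n" by auto
  qed (use t0_pos in simp)
  then show ?thesis by blast
qed

definition limit_value :: "'a set \<Rightarrow> real" where
  "limit_value A = (SOME L. \<forall>n. ratio_band (real n * t\<^sub>0) A (L - rate ^ n) (L + rate ^ n))"

lemma limit_value_band:
  "A \<in> sets E \<Longrightarrow> ratio_band (real n * t\<^sub>0) A (limit_value A - rate ^ n) (limit_value A + rate ^ n)"
  using someI_ex[OF limit_value_exists] unfolding limit_value_def by blast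

lemma rate_power_tendsto: "(\<lambda>n. rate ^ n) \<longlonglongrightarrow> 0"
  using rate_nonneg rate_less_1 by (rule LIMSEQ_realpow_zero)

lemma ratio_tendsto_limit_value:
  assumes A: "A \<in> sets E" and x: "x \<in> space E"
  shows "(\<lambda>n. q (real n * t\<^sub>0) A x / surv (real n * t\<^sub>0) x) \<longlonglongrightarrow> limit_value A"
proof (rule LIM_zero_cancel)
  show "(\<lambda>n. q (real n * t\<^sub>0) A x / surv (real n * t\<^sub>0) x - limit_value A) \<longlonglongrightarrow> 0"
  proof (rule Lim_null_comparison[OF _ rate_power_tendsto], rule always_eventually, rule allI)
    fix n
    have s: "0 < surv (real n * t\<^sub>0) x" using survives x t0_pos by simp
    have "(limit_value A - rate ^ n) * surv (real n * t\<^sub>0) x \<le> q (real n * t\<^sub>0) A x"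
      "q (real n * t\<^sub>0) A x \<le> (limit_value A + rate ^ n) * surv (real n * t\<^sub>0) x"
      using limit_value_band[OF A] x by (auto simp: ratio_band_def)
    then have "limit_value A - rate ^ n \<le> q (real n * t\<^sub>0) A x / surv (real n * t\<^sub>0) x"
      "q (real n * t\<^sub>0) A x / surv (real n * t\<^sub>0) x \<le> limit_value A + rate ^ n"
      using s by (simp_all add: pos_le_divide_eq pos_divide_le_eq)
    then show "norm (q (real n * t\<^sub>0) A x / surv (real n * t\<^sub>0) x - limit_value A) \<le> rate ^ n"
      by (simp add: abs_le_iff)
  qed
qed

lemma limit_value_nonneg: "A \<in> sets E \<Longrightarrow> 0 \<le> limit_value A"
  using space_nonempty by (auto intro: LIMSEQ_le_const[OF ratio_tendsto_limit_value])

lemma limit_value_space: "limit_value (space E) = 1"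
proof -
  obtain x where x: "x \<in> space E" using space_nonempty by blast
  have "surv (real n * t\<^sub>0) x \<noteq> 0" for n using survives[of "real n * t\<^sub>0" x] x t0_pos by simp
  then show ?thesis
    using ratio_tendsto_limit_value[OF sets.top x] by (simp add: LIMSEQ_const_iff)
qed

lemma limit_value_add:
  assumes "A \<in> sets E" "B \<in> sets E" "A \<inter> B = {}"
  shows "limit_value (A \<union> B) = limit_value A + limit_value B"
proof -
  obtain x where x: "x \<in> space E" using space_nonempty by blast
  have "q t (A \<union> B) x = q t A x + q t B x" if "0 \<le> t" for t
    using finite_measure.finite_measure_Union[OF finite_measure_Q[OF that x]] assms sets_Q[OF that x] by simp
  then have "(\<lambda>n. q (real n * t\<^sub>0) (A \<union> B) x / surv (real n * t\<^sub>0) x)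
      = (\<lambda>n. q (real n * t\<^sub>0) A x / surv (real n * t\<^sub>0) x + q (real n * t\<^sub>0) B x / surv (real n * t\<^sub>0) x)"
    using t0_pos by (simp add: add_divide_distrib)
  moreover have "\<dots> \<longlonglongrightarrow> limit_value A + limit_value B"
    using assms x by (intro tendsto_add ratio_tendsto_limit_value)
  ultimately show ?thesis
    using ratio_tendsto_limit_value[of "A \<union> B" x] assms x LIMSEQ_unique by fastforce
qed

lemma q_t0_bounds:
  assumes x: "x \<in> space E" and A: "A \<in> sets E"
  shows "1 / c\<^sup>2 * measure \<mu> A * surv t\<^sub>0 x \<le> q t\<^sub>0 A x" "q t\<^sub>0 A x \<le> c\<^sup>2 * measure \<mu> A * surv t\<^sub>0 x"
proof -
  have E: "1 / c * f x \<le> surv t\<^sub>0 x" "surv t\<^sub>0 x \<le> c * f x"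
    using two_sided[OF x sets.top] mu_space by simp_all
  have "1 / c\<^sup>2 * measure \<mu> A * surv t\<^sub>0 x \<le> 1 / c\<^sup>2 * measure \<mu> A * (c * f x)"
    using E by (intro mult_left_mono) auto
  also have "\<dots> = 1 / c * f x * measure \<mu> A" using c_pos by (simp add: field_simps power2_eq_square)
  also have "\<dots> \<le> q t\<^sub>0 A x" using two_sided[OF x A] by simp
  finally show "1 / c\<^sup>2 * measure \<mu> A * surv t\<^sub>0 x \<le> q t\<^sub>0 A x" .
  have "q t\<^sub>0 A x \<le> c * f x * measure \<mu> A" using two_sided[OF x A] by simp
  also have "\<dots> = c\<^sup>2 * measure \<mu> A * (1 / c * f x)" using c_pos by (simp add: field_simps power2_eq_square)
  also have "\<dots> \<le> c\<^sup>2 * measure \<mu> A * surv t\<^sub>0 x" using E by (intro mult_left_mono) auto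
  finally show "q t\<^sub>0 A x \<le> c\<^sup>2 * measure \<mu> A * surv t\<^sub>0 x" .
qed

lemma ratio_band_t0: "A \<in> sets E \<Longrightarrow> ratio_band t\<^sub>0 A (1 / c\<^sup>2 * measure \<mu> A) (c\<^sup>2 * measure \<mu> A)"
  using q_t0_bounds by (simp add: ratio_band_def)

text \<open>
  The last stretch of length \<open>t\<^sub>0\<close> before any time \<open>n * t\<^sub>0\<close> with \<open>n \<ge> 1\<close> already forces this bound.
\<close>

lemma limit_value_le:
  assumes A: "A \<in> sets E"
  shows "limit_value A \<le> c\<^sup>2 * measure \<mu> A"
proof -
  obtain x where x: "x \<in> space E" using space_nonempty by blast
  have "q (real n * t\<^sub>0) A x / surv (real n * t\<^sub>0) x \<le> c\<^sup>2 * measure \<mu> A" if "1 \<le> n" for n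
  proof -
    have "real n * t\<^sub>0 = real (n - 1) * t\<^sub>0 + t\<^sub>0" using that by (simp add: of_nat_diff algebra_simps)
    then have "ratio_band (real n * t\<^sub>0) A (1 / c\<^sup>2 * measure \<mu> A) (c\<^sup>2 * measure \<mu> A)"
      using ratio_band_later[OF _ _ A ratio_band_t0[OF A], of "real (n - 1) * t\<^sub>0"] t0_pos by simp
    then show ?thesis
      using survives[of "real n * t\<^sub>0" x] x t0_pos by (simp add: ratio_band_def pos_divide_le_eq)
  qed
  then show ?thesis
    using LIMSEQ_le_const2[OF ratio_tendsto_limit_value[OF A x]] by blast
qed

definition limit_law :: "'a measure" where
  "limit_law = measure_of (space E) (sets E) (\<lambda>A. ennreal (limit_value A))"

lemma sets_limit_law: "sets limit_law = sets E" and space_limit_law: "space limit_law = space E"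
  by (simp_all add: limit_law_def)

text \<open>
  Countable additivity amounts to continuity at the empty set, which is inherited from \<open>\<mu>\<close>
  through the domination by \<open>c\<^sup>2 \<mu>\<close>.
\<close>

lemma emeasure_limit_law:
  assumes A: "A \<in> sets E"
  shows "emeasure limit_law A = ennreal (limit_value A)"
proof -
  let ?L = "\<lambda>A. ennreal (limit_value A)"
  have "limit_value {} = 0" using limit_value_add[of "{}" "{}"] by simp
  then have pos: "positive (sets E) ?L" by (simp add: positive_def)
  have add: "additive (sets E) ?L"
    by (simp add: additive_def limit_value_add limit_value_nonneg ennreal_plus)
  have "countably_additive (sets E) ?L"
  proof (rule sets.empty_continuous_imp_countably_additive[OF pos add])
    fix B :: "nat \<Rightarrow> 'a set"
    assume B: "range B \<subseteq> sets E" "decseq B" "(\<Inter>i. B i) = {}"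
    interpret prob_space \<mu> by (rule prob_mu)
    have "(\<lambda>i. measure \<mu> (B i)) \<longlonglongrightarrow> measure \<mu> (\<Inter>i. B i)"
      using B sets_mu by (intro finite_Lim_measure_decseq) auto
    then have "(\<lambda>i. c\<^sup>2 * measure \<mu> (B i)) \<longlonglongrightarrow> c\<^sup>2 * 0"
      using B by (intro tendsto_intros) simp
    then have "(\<lambda>i. c\<^sup>2 * measure \<mu> (B i)) \<longlonglongrightarrow> 0" by simp
    moreover have "\<forall>\<^sub>F i in sequentially. norm (limit_value (B i)) \<le> c\<^sup>2 * measure \<mu> (B i)"
      using B(1) limit_value_nonneg limit_value_le by (intro always_eventually) auto
    ultimately have "(\<lambda>i. limit_value (B i)) \<longlonglongrightarrow> 0"
      by (rule Lim_null_comparison[rotated])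
    from tendsto_ennrealI[OF this] show "(\<lambda>i. ?L (B i)) \<longlonglongrightarrow> 0" by simp
  qed simp
  then show ?thesis
    unfolding limit_law_def using pos A
    by (intro emeasure_measure_of_sigma sets.sigma_algebra_axioms) auto
qed

lemma measure_limit_law: "A \<in> sets E \<Longrightarrow> measure limit_law A = limit_value A"
  by (simp add: measure_def emeasure_limit_law limit_value_nonneg)

lemma limit_law_prob: "limit_law \<in> space (prob_algebra E)"
  by (auto simp: space_prob_algebra sets_limit_law space_limit_law emeasure_limit_law
      limit_value_space intro!: prob_spaceI)

text \<open>
  Fix \<open>x\<close> and \<open>T = n * t\<^sub>0\<close>. The normalised law \<open>Q T x / surv T x\<close> is within \<open>rate ^ n\<close> of the limit law,
  uniformly over all sets. So integrating \<open>q t A\<close> and \<open>surv t\<close> against it approximates the two sides,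
  while \<open>Q T x\<close> integrates them to \<open>q (t + T) A x\<close> and \<open>surv (t + T) x\<close>, whose ratio lies in the band
  around the limit value. Each of the three approximations costs at most \<open>rate ^ n\<close>.
\<close>

lemma limit_law_invariant:
  assumes t: "0 \<le> t" and A: "A \<in> sets E"
  shows "mass limit_law t A = limit_value A * mass limit_law t (space E)"
proof -
  obtain x where x: "x \<in> space E" using space_nonempty by blast
  have fin: "finite_measure limit_law"
    using limit_law_prob by (simp add: space_prob_algebra prob_space_def)
  let ?L = "limit_value A" and ?a = "mass limit_law t A" and ?b = "mass limit_law t (space E)"
  have L: "0 \<le> ?L" using A by (rule limit_value_nonneg)
  have L1: "?L \<le> 1"
    using finite_measure.bounded_measure[OF fin, of A] measure_limit_law A
    by (simp add: space_limit_law limit_value_space)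
  have main: "\<bar>?a - ?L * ?b\<bar> \<le> 3 * rate ^ n" for n
  proof -
    define T where "T = real n * t\<^sub>0"
    have T: "0 \<le> T" unfolding T_def using t0_pos by simp
    define s where "s = surv T x"
    have s: "0 < s" unfolding s_def using T x by (rule survives)
    have finQ: "finite_measure (Q T x)" "sets (Q T x) = sets E"
      using T x finite_measure_Q sets_Q by auto
    have near: "mass (Q T x) t C \<le> s * mass limit_law t C + s * rate ^ n"
      "s * mass limit_law t C \<le> mass (Q T x) t C + s * rate ^ n" if C: "C \<in> sets E" for C
    proof -
      have m: "q t C \<in> borel_measurable E" using t C by (rule measurable_Q)
      have *: "1 * measure (Q T x) B \<le> s * measure limit_law B + s * rate ^ n"
        "s * measure limit_law B \<le> 1 * measure (Q T x) B + s * rate ^ n" if "B \<in> sets E" for B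
        using limit_value_band[OF that, of n] x measure_limit_law[OF that]
        by (auto simp: ratio_band_def s_def T_def algebra_simps)
      show "mass (Q T x) t C \<le> s * mass limit_law t C + s * rate ^ n"
        using integral_le_of_measure_le[OF finQ(1) fin finQ(2) sets_limit_law, where a = 1 and b = s and B = 1 and h = "q t C"]
          *(1) s m q_le_1[OF t] by (simp add: mass_def)
      show "s * mass limit_law t C \<le> mass (Q T x) t C + s * rate ^ n"
        using integral_le_of_measure_le[OF fin finQ(1) sets_limit_law finQ(2), where a = s and b = 1 and B = 1 and h = "q t C"]
          *(2) s m q_le_1[OF t] by (simp add: mass_def)
    qed
    define u where "u = mass (Q T x) t A"
    define v where "v = mass (Q T x) t (space E)"
    have uv: "u = q (t + T) A x" "v = surv (t + T) x"
      using q_eq_mass[OF T t x] A by (simp_all add: u_def v_def add.commute)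
    have v: "0 \<le> v" "v \<le> s"
      using surv_antimono[OF T _ x, of "t + T"] t by (simp_all add: uv s_def)
    have "ratio_band (t + T) A (?L - rate ^ n) (?L + rate ^ n)"
      unfolding T_def using t t0_pos A by (intro ratio_band_later limit_value_band) auto
    then have "(?L - rate ^ n) * v \<le> u" "u \<le> (?L + rate ^ n) * v"
      using x by (auto simp: ratio_band_def uv)
    then have uLv: "?L * v - rate ^ n * v \<le> u" "u \<le> ?L * v + rate ^ n * v"
      by (simp_all add: algebra_simps)
    have rv: "rate ^ n * v \<le> s * rate ^ n"
      using v rate_nonneg by (simp add: mult.commute mult_right_mono)
    have Lvb: "?L * v \<le> ?L * (s * ?b + s * rate ^ n)" "?L * (s * ?b) \<le> ?L * (v + s * rate ^ n)"
      using near[OF sets.top] L by (auto intro!: mult_left_mono simp: v_def)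
    have Lr: "?L * (s * rate ^ n) \<le> s * rate ^ n"
      using L1 s rate_nonneg by (intro mult_left_le_one_le) (auto simp: L)
    have "s * ?a \<le> ?L * (s * ?b) + 3 * (s * rate ^ n)" "?L * (s * ?b) \<le> s * ?a + 3 * (s * rate ^ n)"
      using near[OF A] uLv rv Lvb Lr unfolding u_def[symmetric] distrib_left by linarith+
    then have "s * ?a \<le> s * (?L * ?b + 3 * rate ^ n)" "s * (?L * ?b) \<le> s * (?a + 3 * rate ^ n)"
      by (simp_all only: distrib_left mult.left_commute)
    then have "?a \<le> ?L * ?b + 3 * rate ^ n" "?L * ?b \<le> ?a + 3 * rate ^ n"
      using s mult_le_cancel_left_pos by blast+
    then show ?thesis by (simp add: abs_le_iff)
  qed
  have "(\<lambda>n. 3 * rate ^ n) \<longlonglongrightarrow> 3 * 0" by (intro tendsto_intros rate_power_tendsto)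
  then have "\<bar>?a - ?L * ?b\<bar> \<le> 0"
    using main LIMSEQ_le_const by fastforce
  then show ?thesis by simp
qed

text \<open>
  Quasi-stationarity in terms of the kernels alone.
\<close>

definition invariant_law :: "'a measure \<Rightarrow> bool" where
  "invariant_law \<alpha> \<longleftrightarrow> \<alpha> \<in> space (prob_algebra E) \<and>
     (\<forall>t\<ge>0. \<forall>A\<in>sets E. measure \<alpha> A = mass \<alpha> t A / mass \<alpha> t (space E))"

lemma invariant_law_limit_law: "invariant_law limit_law"
  unfolding invariant_law_def
proof (intro conjI allI impI ballI limit_law_prob)
  fix t :: real and A assume t: "0 \<le> t" and A: "A \<in> sets E"
  show "measure limit_law A = mass limit_law t A / mass limit_law t (space E)"
    using limit_law_invariant[OF t A] mass_space_pos[OF limit_law_prob t]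
    by (simp add: measure_limit_law A)
qed

lemma invariant_law_in_band:
  assumes \<alpha>: "invariant_law \<alpha>" and "0 \<le> T" "A \<in> sets E" and band: "ratio_band T A lo hi"
  shows "lo \<le> measure \<alpha> A" "measure \<alpha> A \<le> hi"
proof -
  have p: "\<alpha> \<in> space (prob_algebra E)" using \<alpha> by (simp add: invariant_law_def)
  then have fin: "finite_measure \<alpha>" "sets \<alpha> = sets E"
    by (simp_all add: space_prob_algebra prob_space_def)
  have "0 < mass \<alpha> T (space E)" using p assms(2) by (rule mass_space_pos)
  then show "lo \<le> measure \<alpha> A" "measure \<alpha> A \<le> hi"
    using mass_in_band[OF fin assms(2,3) band] \<alpha> assms(2,3)
    by (simp_all add: invariant_law_def pos_le_divide_eq pos_divide_le_eq)
qed

lemma invariant_law_unique: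
  assumes \<alpha>: "invariant_law \<alpha>"
  shows "\<alpha> = limit_law"
proof (rule measure_eqI)
  have p: "prob_space \<alpha>" "sets \<alpha> = sets E"
    using \<alpha> by (simp_all add: invariant_law_def space_prob_algebra)
  show s: "sets \<alpha> = sets limit_law" using p sets_limit_law by simp
  fix A assume "A \<in> sets \<alpha>"
  then have A: "A \<in> sets E" using p by simp
  have "\<bar>measure \<alpha> A - limit_value A\<bar> \<le> rate ^ n" for n
    using invariant_law_in_band[OF \<alpha> _ A limit_value_band[OF A, of n]] t0_pos by (simp add: abs_le_iff)
  then have "\<bar>measure \<alpha> A - limit_value A\<bar> \<le> 0"
    using LIMSEQ_le_const[OF rate_power_tendsto] by blast
  then have "measure \<alpha> A = limit_value A" by simp
  then show "emeasure \<alpha> A = emeasure limit_law A"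
    using p(1) A by (simp add: emeasure_limit_law finite_measure.emeasure_eq_measure prob_space_def)
qed

lemma invariant_law_bounds:
  "invariant_law \<alpha> \<Longrightarrow> A \<in> sets E \<Longrightarrow> 1 / c\<^sup>2 * measure \<mu> A \<le> measure \<alpha> A"
  "invariant_law \<alpha> \<Longrightarrow> A \<in> sets E \<Longrightarrow> measure \<alpha> A \<le> c\<^sup>2 * measure \<mu> A"
  using invariant_law_in_band[OF _ _ _ ratio_band_t0] t0_pos by auto

end

section \<open>The killed process\<close>

context absorbed_markov_process
begin

abbreviation S :: "'a measure" where
  "S \<equiv> cemetery_space E d"

lemma space_S: "space S = insert d (space E)"
  unfolding cemetery_space_def
  by (rule space_measure_of) (use sets.sets_into_space in auto)

lemma sets_S: "sets S = sigma_sets (insert d (space E)) (insert {d} (sets E))"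
  unfolding cemetery_space_def
  by (rule sets_measure_of) (use sets.sets_into_space in auto)

lemma sets_E_in_S: "A \<in> sets E \<Longrightarrow> A \<in> sets S"
  by (simp add: sets_S sigma_sets.Basic)

text \<open>
  The singleton of the cemetery point is the only generator outside \<open>E\<close>, and it has empty trace.
\<close>

lemma trace_S: "B \<in> sets S \<Longrightarrow> B \<inter> space E \<in> sets E"
  unfolding sets_S
proof (induction rule: sigma_sets.induct)
  case (Basic B)
  then show ?case using cemetery sets.sets_into_space by auto
next
  case (Compl B)
  have "(insert d (space E) - B) \<inter> space E = space E - B \<inter> space E" by auto
  then show ?case using Compl by auto
next
  case (Union B)
  then have "(\<Union>i. B i \<inter> space E) \<in> sets E" by blast
  then show ?case by simp
qed simp

lemma measurable_P_E: "P \<in> E \<rightarrow>\<^sub>M prob_algebra M"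
proof -
  have "(\<lambda>x. x) \<in> E \<rightarrow>\<^sub>M S"
  proof (rule measurableI)
    fix B assume "B \<in> sets S"
    then show "(\<lambda>x. x) -` B \<inter> space E \<in> sets E" using trace_S by simp
  qed (simp add: space_S)
  from measurable_compose[OF this kernel_P] show ?thesis .
qed

lemma prob_space_P: "x \<in> space S \<Longrightarrow> prob_space (P x)"
  and sets_P: "x \<in> space S \<Longrightarrow> sets (P x) = sets M"
  using measurable_space[OF kernel_P] by (auto simp: space_prob_algebra)

lemma space_P: "x \<in> space S \<Longrightarrow> space (P x) = space M"
  using sets_P sets_eq_imp_space_eq by blast

lemma measurable_X_P: "x \<in> space S \<Longrightarrow> 0 \<le> t \<Longrightarrow> X t \<in> P x \<rightarrow>\<^sub>M S"
  by (subst measurable_cong_sets[OF sets_P refl]) (auto intro: measurable_X)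

lemma event_in_M: "0 \<le> t \<Longrightarrow> A \<in> sets S \<Longrightarrow> {\<omega> \<in> space M. X t \<omega> \<in> A} \<in> sets M"
  using measurable_sets[OF measurable_X, of t A] by (simp add: vimage_def Int_def conj_commute)

text \<open>
  The infimum in the absorption time need not be attained a priori; that the process sits at the
  cemetery point from this time on is part of the absorption axiom.
\<close>

lemma alive_iff:
  assumes "\<omega> \<in> space M" "0 \<le> t"
  shows "ereal t < absorption_time X d \<omega> \<longleftrightarrow> X t \<omega> \<in> space E"
proof -
  have "X t \<omega> \<in> insert d (space E)"
    using measurable_space[OF measurable_X[OF assms(2)] assms(1)] space_S by simp
  moreover have "absorption_time X d \<omega> \<le> ereal t" if "X t \<omega> = d"
    unfolding absorption_time_def using assms(2) that by (intro Inf_lower) auto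
  moreover have "X t \<omega> = d" if "absorption_time X d \<omega> \<le> ereal t"
    using absorbed[OF assms that] .
  ultimately show ?thesis using cemetery by (metis insertE linorder_not_less)
qed

lemma alive_event: "0 \<le> t \<Longrightarrow>
    {\<omega> \<in> space M. ereal t < absorption_time X d \<omega>} = {\<omega> \<in> space M. X t \<omega> \<in> space E}"
  using alive_iff by blast

text \<open>
  Started at the cemetery point, the process is there at time 0 almost surely, although possibly
  not for every outcome; on that event the absorption time is at most 0.
\<close>

lemma never_revived:
  assumes "0 \<le> t" "A \<in> sets E"
  shows "measure (P d) {\<omega> \<in> space M. X t \<omega> \<in> A} = 0"
proof -
  have d: "d \<in> space S" by (simp add: space_S)
  have dE: "{d} \<in> sets S" by (simp add: sets_S sigma_sets.Basic)
  interpret prob_space "P d" using d by (rule prob_space_P)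
  have "measure (distr (P d) S (X 0)) {d} = 1"
    using start[OF d] d dE by (simp add: measure_return)
  then have "prob (X 0 -` {d} \<inter> space M) = 1"
    using measure_distr[OF measurable_X_P[OF d] dE, of 0] space_P[OF d] by simp
  moreover have "X 0 -` {d} \<inter> space M \<subseteq> space M - {\<omega> \<in> space M. X t \<omega> \<in> A}"
  proof
    fix \<omega> assume \<omega>: "\<omega> \<in> X 0 -` {d} \<inter> space M"
    then have "absorption_time X d \<omega> \<le> ereal 0"
      unfolding absorption_time_def by (intro Inf_lower) auto
    also have "\<dots> \<le> ereal t" using assms by simp
    finally have "X t \<omega> = d" using absorbed \<omega> assms by blast
    moreover have "d \<notin> A" using cemetery sets.sets_into_space[OF assms(2)] by blast
    ultimately show "\<omega> \<in> space M - {\<omega> \<in> space M. X t \<omega> \<in> A}" using \<omega> by auto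
  qed
  moreover have ev: "{\<omega> \<in> space M. X t \<omega> \<in> A} \<in> sets (P d)"
    using event_in_M[OF assms(1) sets_E_in_S[OF assms(2)]] sets_P[OF d] by simp
  ultimately have "1 \<le> prob (space M - {\<omega> \<in> space M. X t \<omega> \<in> A})"
    by (metis (no_types, lifting) finite_measure_mono sets.compl_sets space_P[OF d])
  then show ?thesis
    using prob_compl[OF ev] space_P[OF d] measure_nonneg[of "P d"] by (simp add: order_antisym)
qed

text \<open>
  Restriction to \<open>E\<close> discards the mass at the cemetery point, which makes this a sub-probability.
\<close>

definition killed_kernel :: "real \<Rightarrow> 'a \<Rightarrow> 'a measure" where
  "killed_kernel t x = restrict_space (distr (P x) S (X t)) (space E)"

lemma sets_killed_kernel: "sets (killed_kernel t x) = sets E"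
proof
  show "sets (killed_kernel t x) \<subseteq> sets E"
    using trace_S by (auto simp: killed_kernel_def sets_restrict_space Int_commute)
  show "sets E \<subseteq> sets (killed_kernel t x)"
  proof
    fix A assume A: "A \<in> sets E"
    then have "A = space E \<inter> A" using sets.sets_into_space by blast
    then show "A \<in> sets (killed_kernel t x)"
      using sets_E_in_S[OF A] by (auto simp: killed_kernel_def sets_restrict_space)
  qed
qed

lemma measure_killed_kernel:
  assumes "x \<in> space S" "0 \<le> t" "A \<in> sets E"
  shows "measure (killed_kernel t x) A = measure (P x) {\<omega> \<in> space M. X t \<omega> \<in> A}"
proof -
  have "measure (killed_kernel t x) A = measure (distr (P x) S (X t)) A"
    unfolding killed_kernel_def
    by (rule measure_restrict_space)
      (use sets.sets_into_space[OF assms(3)] space_S sets_E_in_S[OF sets.top] in \<open>auto simp: Int_absorb2 subset_insertI\<close>)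
  also have "\<dots> = measure (P x) (X t -` A \<inter> space (P x))"
    using assms sets_E_in_S by (intro measure_distr measurable_X_P)
  also have "X t -` A \<inter> space (P x) = {\<omega> \<in> space M. X t \<omega> \<in> A}"
    using space_P[OF assms(1)] by auto
  finally show ?thesis .
qed

lemma measurable_event_prob:
  assumes "0 \<le> t" "A \<in> sets S"
  shows "(\<lambda>x. measure (P x) {\<omega> \<in> space M. X t \<omega> \<in> A}) \<in> borel_measurable S"
  using measurable_compose[OF kernel_P measurable_measure_prob_algebra[OF event_in_M[OF assms]]] .

lemma history_subalgebra:
  assumes "x \<in> space S" "0 \<le> s"
  shows "subalgebra (P x) (history M S X s)"
proof -
  let ?G = "{X u -` A \<inter> space M | u A. 0 \<le> u \<and> u \<le> s \<and> A \<in> sets S}"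
  have G: "?G \<subseteq> sets M" using measurable_sets[OF measurable_X] by auto
  then have GP: "?G \<subseteq> Pow (space M)" using sets.sets_into_space by blast
  have "sigma_sets (space M) ?G \<subseteq> sets M" using G by (rule sets.sigma_sets_subset)
  then show ?thesis
    unfolding subalgebra_def history_def
    using GP sets_P[OF assms(1)] space_P[OF assms(1)] by (simp add: sets_measure_of space_measure_of)
qed

text \<open>
  The expectation of the conditional Markov property. The conditional expectation keeps the integral, and
  the law of \<open>X s\<close> is all that remains of the path up to time \<open>s\<close>.
\<close>

lemma simple_markov:
  assumes x: "x \<in> space S" and s: "0 \<le> s" and t: "0 \<le> t" and A: "A \<in> sets S"
  shows "measure (P x) {\<omega> \<in> space M. X (s + t) \<omega> \<in> A}
    = (\<integral>y. measure (P y) {\<omega> \<in> space M. X t \<omega> \<in> A} \<partial>distr (P x) S (X s))"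
proof -
  interpret prob_space "P x" using x by (rule prob_space_P)
  interpret finite_measure_subalgebra "P x" "history M S X s"
    by unfold_locales (rule history_subalgebra[OF x s])
  let ?B = "{\<omega> \<in> space M. X (s + t) \<omega> \<in> A}"
  have B: "?B \<in> sets (P x)" using event_in_M[of "s + t" A] s t A sets_P[OF x] by simp
  then have int: "integrable (P x) (indicator ?B :: _ \<Rightarrow> real)"
    by (simp add: integrable_indicator_iff emeasure_eq_measure less_top[symmetric])
  have meas: "(\<lambda>\<omega>. measure (P (X s \<omega>)) {\<omega> \<in> space M. X t \<omega> \<in> A}) \<in> borel_measurable (P x)"
    by (rule measurable_compose[OF measurable_X_P[OF x s] measurable_event_prob[OF t A]])
  have "measure (P x) ?B = (\<integral>\<omega>. indicator ?B \<omega> \<partial>P x)" using B by simp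
  also have "\<dots> = (\<integral>\<omega>. real_cond_exp (P x) (history M S X s) (indicator ?B) \<omega> \<partial>P x)"
    using real_cond_exp_int(2)[OF int] by simp
  also have "\<dots> = (\<integral>\<omega>. measure (P (X s \<omega>)) {\<omega> \<in> space M. X t \<omega> \<in> A} \<partial>P x)"
  proof (rule integral_cong_AE[OF _ meas])
    show "AE \<omega> in P x. real_cond_exp (P x) (history M S X s) (indicator ?B) \<omega>
        = measure (P (X s \<omega>)) {\<omega> \<in> space M. X t \<omega> \<in> A}"
      using markov[OF x s t A] AE_space
    proof eventually_elim
      case (elim \<omega>)
      have "X s \<omega> \<in> space S" using measurable_space[OF measurable_X_P[OF x s] elim(2)] .
      then show ?case using elim(1) space_P by simp
    qed
  qed simp
  also have "\<dots> = (\<integral>y. measure (P y) {\<omega> \<in> space M. X t \<omega> \<in> A} \<partial>distr (P x) S (X s))"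
    by (rule integral_distr[symmetric, OF measurable_X_P[OF x s] measurable_event_prob[OF t A]])
  finally show ?thesis .
qed

text \<open>
  The mass of the intermediate law at the cemetery point can be dropped, as nothing returns from there.
\<close>

lemma killed_kernel_Chapman_Kolmogorov:
  assumes x: "x \<in> space S" and s: "0 \<le> s" and t: "0 \<le> t" and A: "A \<in> sets E"
  shows "measure (killed_kernel (s + t) x) A = (\<integral>y. measure (killed_kernel t y) A \<partial>killed_kernel s x)"
proof -
  have "measure (killed_kernel (s + t) x) A
      = (\<integral>y. measure (P y) {\<omega> \<in> space M. X t \<omega> \<in> A} \<partial>distr (P x) S (X s))"
    using measure_killed_kernel[OF x _ A] simple_markov[OF x s t sets_E_in_S[OF A]] s t by simp
  also have "\<dots> = (\<integral>y. indicator (space E) y *\<^sub>R measure (killed_kernel t y) A \<partial>distr (P x) S (X s))"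
  proof (rule Bochner_Integration.integral_cong)
    fix y assume "y \<in> space (distr (P x) S (X s))"
    then have "y = d \<or> y \<in> space E" "y \<in> space S" by (auto simp: space_S)
    then show "measure (P y) {\<omega> \<in> space M. X t \<omega> \<in> A} = indicator (space E) y *\<^sub>R measure (killed_kernel t y) A"
      using never_revived[OF t A] cemetery measure_killed_kernel[OF _ t A] by auto
  qed simp
  also have "\<dots> = (\<integral>y. measure (killed_kernel t y) A \<partial>killed_kernel s x)"
    unfolding killed_kernel_def[of s x]
    by (rule integral_restrict_space[symmetric]) (simp add: space_S sets_E_in_S Int_absorb2 subset_insertI)
  finally show ?thesis .
qed

sublocale killed: sub_markov_semigroup E killed_kernel
proof (rule sub_markov_semigroup.intro)
  fix t :: real and x assume t: "0 \<le> t" and x: "x \<in> space E"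
  have xS: "x \<in> space S" using x space_S by simp
  interpret prob_space "P x" using xS by (rule prob_space_P)
  show "sets (killed_kernel t x) = sets E" by (rule sets_killed_kernel)
  have sp: "space (killed_kernel t x) = space E"
    using sets_eq_imp_space_eq[OF sets_killed_kernel] .
  have sE: "space E \<in> sets S" using sets_E_in_S[OF sets.top] .
  show "subprob_space (killed_kernel t x)"
  proof (rule subprob_spaceI)
    have "emeasure (killed_kernel t x) (space E) = emeasure (distr (P x) S (X t)) (space E)"
      unfolding killed_kernel_def
      by (rule emeasure_restrict_space) (use sE in \<open>simp_all add: space_S Int_absorb2 subset_insertI\<close>)
    also have "\<dots> \<le> 1"
      using prob_space.emeasure_le_1[OF prob_space_distr[OF measurable_X_P[OF xS t]]] .
    finally show "emeasure (killed_kernel t x) (space (killed_kernel t x)) \<le> 1" using sp by simp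
    show "space (killed_kernel t x) \<noteq> {}" using sp x by auto
  qed
  show "0 < measure (killed_kernel t x) (space E)"
    using survival[OF x t] measure_killed_kernel[OF xS t sets.top] alive_event[OF t] space_P[OF xS] by simp
next
  fix t :: real and A assume t: "0 \<le> t" and A: "A \<in> sets E"
  have "(\<lambda>x. measure (P x) {\<omega> \<in> space M. X t \<omega> \<in> A}) \<in> borel_measurable E"
    by (rule measurable_compose[OF measurable_P_E measurable_measure_prob_algebra[OF event_in_M[OF t sets_E_in_S[OF A]]]])
  then show "(\<lambda>x. measure (killed_kernel t x) A) \<in> borel_measurable E"
    using measurable_cong[of E "\<lambda>x. measure (killed_kernel t x) A"] measure_killed_kernel[OF _ t A] space_S by simp
next
  fix s t :: real and x A
  assume "0 \<le> s" "0 \<le> t" "x \<in> space E" "A \<in> sets E"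
  then show "measure (killed_kernel (s + t) x) A = (\<integral>y. measure (killed_kernel t y) A \<partial>killed_kernel s x)"
    using space_S by (intro killed_kernel_Chapman_Kolmogorov) auto
qed

lemma start_prob: "x \<in> space E \<Longrightarrow> 0 \<le> t \<Longrightarrow> A \<in> sets E \<Longrightarrow>
    \<P>(\<omega> in P x. X t \<omega> \<in> A) = measure (killed_kernel t x) A"
  using measure_killed_kernel space_S space_P by simp

lemma start_survival: "x \<in> space E \<Longrightarrow> 0 \<le> t \<Longrightarrow>
    \<P>(\<omega> in P x. ereal t < absorption_time X d \<omega>) = measure (killed_kernel t x) (space E)"
  using measure_killed_kernel[of x t "space E"] alive_event space_S space_P by simp

lemma alive_and_in: "0 \<le> t \<Longrightarrow> A \<in> sets E \<Longrightarrow>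
    {\<omega> \<in> space M. X t \<omega> \<in> A \<and> ereal t < absorption_time X d \<omega>} = {\<omega> \<in> space M. X t \<omega> \<in> A}"
  using alive_iff sets.sets_into_space by blast

lemma start_conditioned: "x \<in> space E \<Longrightarrow> 0 \<le> t \<Longrightarrow> A \<in> sets E \<Longrightarrow>
    conditioned_law X d (P x) t A = measure (killed_kernel t x) A / measure (killed_kernel t x) (space E)"
  using measure_killed_kernel[of x t] alive_event alive_and_in space_S space_P
  by (simp add: conditioned_law_def cond_prob_def)

lemma mixture_event:
  assumes \<pi>: "\<pi> \<in> space (prob_algebra E)" and t: "0 \<le> t" and A: "A \<in> sets E"
  shows "space (\<pi> \<bind> P) = space M"
    and "measure (\<pi> \<bind> P) {\<omega> \<in> space M. X t \<omega> \<in> A} = killed.mass \<pi> t A"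
proof -
  interpret prob_space \<pi> using \<pi> by (simp add: space_prob_algebra)
  have s: "sets \<pi> = sets E" using \<pi> by (simp add: space_prob_algebra)
  then have sp: "space \<pi> = space E" by (rule sets_eq_imp_space_eq)
  have K: "P \<in> \<pi> \<rightarrow>\<^sub>M subprob_algebra M"
    unfolding measurable_cong_sets[OF s refl] by (rule measurable_prob_algebraD[OF measurable_P_E])
  show "space (\<pi> \<bind> P) = space M"
    using sp not_empty sets_P space_S by (intro space_bind) auto
  have "measure (\<pi> \<bind> P) {\<omega> \<in> space M. X t \<omega> \<in> A} = (\<integral>x. measure (P x) {\<omega> \<in> space M. X t \<omega> \<in> A} \<partial>\<pi>)"
    by (rule measure_bind[OF K event_in_M[OF t sets_E_in_S[OF A]]])
  also have "\<dots> = killed.mass \<pi> t A"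
    unfolding killed.mass_def
    by (rule Bochner_Integration.integral_cong) (use sp space_S measure_killed_kernel[OF _ t A] in auto)
  finally show "measure (\<pi> \<bind> P) {\<omega> \<in> space M. X t \<omega> \<in> A} = killed.mass \<pi> t A" .
qed

lemma mixture_survival:
  assumes "\<pi> \<in> space (prob_algebra E)" "0 \<le> t"
  shows "\<P>(\<omega> in \<pi> \<bind> P. ereal t < absorption_time X d \<omega>) = killed.mass \<pi> t (space E)"
  using mixture_event[OF assms sets.top] alive_event[OF assms(2)] by simp

lemma mixture_conditioned:
  assumes "\<pi> \<in> space (prob_algebra E)" "0 \<le> t" "A \<in> sets E"
  shows "conditioned_law X d (\<pi> \<bind> P) t A = killed.mass \<pi> t A / killed.mass \<pi> t (space E)"
  using mixture_event[OF assms] mixture_survival[OF assms(1,2)] alive_and_in[OF assms(2,3)]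
  by (simp add: conditioned_law_def cond_prob_def)

end

theorem theorem2p1:
  fixes E :: "'a measure" and d :: 'a and M :: "'w measure"
    and X :: "real \<Rightarrow> 'w \<Rightarrow> 'a" and P :: "'a \<Rightarrow> 'w measure"
    and t\<^sub>0 c :: real and \<mu> :: "'a measure" and f :: "'a \<Rightarrow> real"
  assumes "absorbed_markov_process E d M X P"
    and "t\<^sub>0 > 0" and "c > 0"
    and "\<mu> \<in> space (prob_algebra E)"
    and "f \<in> borel_measurable E" and "\<And>x. x \<in> space E \<Longrightarrow> f x > 0"
    and "\<And>x A. x \<in> space E \<Longrightarrow> A \<in> sets E \<Longrightarrow>
      (1 / c) * f x * measure \<mu> A \<le> \<P>(\<omega> in P x. X t\<^sub>0 \<omega> \<in> A) \<and>
      \<P>(\<omega> in P x. X t\<^sub>0 \<omega> \<in> A) \<le> c * f x * measure \<mu> A"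
  shows "condition_A E d X P t\<^sub>0 \<mu> (1 / c ^ 2) (1 / c ^ 3 * (\<integral>x. f x \<partial>\<mu>))
    \<and> (\<forall>\<pi>\<^sub>1\<in>space (prob_algebra E). \<forall>\<pi>\<^sub>2\<in>space (prob_algebra E). \<forall>t\<ge>0.
        tv_norm E (\<lambda>A. conditioned_law X d (\<pi>\<^sub>1 \<bind> P) t A - conditioned_law X d (\<pi>\<^sub>2 \<bind> P) t A)
        \<le> c ^ 3 * ((1 - 1 / c ^ 5 * (\<integral>x. f x \<partial>\<mu>)) ^ nat \<lfloor>t / t\<^sub>0\<rfloor>
              / max (\<integral>x. f x \<partial>\<pi>\<^sub>1) (\<integral>x. f x \<partial>\<pi>\<^sub>2))
          * tv_norm E (\<lambda>A. measure \<pi>\<^sub>1 A - measure \<pi>\<^sub>2 A))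
    \<and> (\<exists>!\<alpha>. quasi_stationary E d X P \<alpha>)
    \<and> (\<forall>\<alpha>. quasi_stationary E d X P \<alpha> \<longrightarrow>
        (\<forall>A\<in>sets E. 1 / c ^ 2 * measure \<mu> A \<le> measure \<alpha> A \<and> measure \<alpha> A \<le> c ^ 2 * measure \<mu> A))"
proof -
  interpret absorbed_markov_process E d M X P by fact
  interpret two_sided_semigroup E killed_kernel t\<^sub>0 c \<mu> f
    using assms(2-7) start_prob by unfold_locales auto
  have F: "0 < (\<integral>x. f x \<partial>\<mu>)" using mu by (rule integral_f_pos)

  have A1: "1 / c ^ 2 * measure \<mu> A \<le> conditioned_law X d (P x) t\<^sub>0 A"
    if "x \<in> space E" "A \<in> sets E" for x A
    using q_t0_bounds(1)[OF that] killed.survives[of t\<^sub>0 x] start_conditioned[OF that(1) _ that(2)] that t0_pos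
    by (simp only: pos_le_divide_eq less_imp_le)
  have A2: "1 / c ^ 3 * (\<integral>x. f x \<partial>\<mu>) * \<P>(\<omega> in P z. ereal t < absorption_time X d \<omega>)
      \<le> \<P>(\<omega> in \<mu> \<bind> P. ereal t < absorption_time X d \<omega>)" if z: "z \<in> space E" and t: "0 \<le> t" for z t
  proof -
    have "killed.surv t z * (\<integral>x. f x \<partial>\<mu>) / c ^ 3 \<le> killed.mass \<mu> t (space E)"
      using surv_le_mass[OF mu t z] c_pos by (simp add: pos_divide_le_eq mult.commute)
    then show ?thesis
      unfolding mixture_survival[OF mu t] start_survival[OF z t] by (simp add: mult.commute)
  qed
  have "condition_A E d X P t\<^sub>0 \<mu> (1 / c ^ 2) (1 / c ^ 3 * (\<integral>x. f x \<partial>\<mu>))"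
    unfolding condition_A_def using A1 A2 t0_pos c_pos F mu by simp

  moreover have "tv_norm E (\<lambda>A. conditioned_law X d (\<pi>\<^sub>1 \<bind> P) t A - conditioned_law X d (\<pi>\<^sub>2 \<bind> P) t A)
        \<le> c ^ 3 * ((1 - 1 / c ^ 5 * (\<integral>x. f x \<partial>\<mu>)) ^ nat \<lfloor>t / t\<^sub>0\<rfloor>
              / max (\<integral>x. f x \<partial>\<pi>\<^sub>1) (\<integral>x. f x \<partial>\<pi>\<^sub>2))
          * tv_norm E (\<lambda>A. measure \<pi>\<^sub>1 A - measure \<pi>\<^sub>2 A)"
    if \<pi>: "\<pi>\<^sub>1 \<in> space (prob_algebra E)" "\<pi>\<^sub>2 \<in> space (prob_algebra E)" and t: "0 \<le> t" for \<pi>\<^sub>1 \<pi>\<^sub>2 t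
  proof -
    define \<Delta> where "\<Delta> = tv_norm E (\<lambda>A. measure \<pi>\<^sub>1 A - measure \<pi>\<^sub>2 A)"
    define G where "G = max (\<integral>x. f x \<partial>\<pi>\<^sub>1) (\<integral>x. f x \<partial>\<pi>\<^sub>2)"
    define k where "k = nat \<lfloor>t / t\<^sub>0\<rfloor>"
    have fin: "finite_measure \<pi>\<^sub>1" "sets \<pi>\<^sub>1 = sets E" "finite_measure \<pi>\<^sub>2" "sets \<pi>\<^sub>2 = sets E"
      using \<pi> by (simp_all add: space_prob_algebra prob_space_def)
    have "\<bar>measure \<pi>\<^sub>1 A - measure \<pi>\<^sub>2 A\<bar> \<le> \<Delta> / 2" if "A \<in> sets E" for A
      unfolding \<Delta>_def using \<pi> that by (rule abs_measure_diff_le_tv_norm)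
    then have close: "measure \<pi>\<^sub>1 A \<le> measure \<pi>\<^sub>2 A + \<Delta> / 2" "measure \<pi>\<^sub>2 A \<le> measure \<pi>\<^sub>1 A + \<Delta> / 2"
      if "A \<in> sets E" for A using that by (smt (verit))+
    have \<Delta>: "0 \<le> \<Delta>" using close(1)[of "{}"] by simp
    have G: "0 < G" unfolding G_def using integral_f_pos[OF \<pi>(1)] by simp
    have "tv_norm E (\<lambda>A. conditioned_law X d (\<pi>\<^sub>1 \<bind> P) t A - conditioned_law X d (\<pi>\<^sub>2 \<bind> P) t A)
        \<le> 2 * (c ^ 3 * (rate ^ k / G) * (\<Delta> / 2))"
    proof (rule tv_norm_le[OF space_nonempty])
      fix A B assume "A \<in> sets E" "B \<in> sets E" "A \<inter> B = {}"
      then show "conditioned_law X d (\<pi>\<^sub>1 \<bind> P) t (A \<union> B) - conditioned_law X d (\<pi>\<^sub>2 \<bind> P) t (A \<union> B)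
          = conditioned_law X d (\<pi>\<^sub>1 \<bind> P) t A - conditioned_law X d (\<pi>\<^sub>2 \<bind> P) t A
            + (conditioned_law X d (\<pi>\<^sub>1 \<bind> P) t B - conditioned_law X d (\<pi>\<^sub>2 \<bind> P) t B)"
        using fin t by (simp add: mixture_conditioned \<pi> killed.mass_add add_divide_distrib)
    next
      fix A assume A: "A \<in> sets E"
      let ?m = "\<bar>killed.mass \<pi>\<^sub>1 t A / killed.mass \<pi>\<^sub>1 t (space E) - killed.mass \<pi>\<^sub>2 t A / killed.mass \<pi>\<^sub>2 t (space E)\<bar>"
      have "?m \<le> c ^ 3 * (rate ^ k / (\<integral>x. f x \<partial>\<pi>\<^sub>1)) * (\<Delta> / 2)"
        unfolding k_def using conditional_difference_le[OF \<pi> t A close] .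
      moreover have "?m \<le> c ^ 3 * (rate ^ k / (\<integral>x. f x \<partial>\<pi>\<^sub>2)) * (\<Delta> / 2)"
        unfolding k_def abs_minus_commute[of "killed.mass \<pi>\<^sub>1 t A / _"]
        using conditional_difference_le[OF \<pi>(2,1) t A close(2,1)] .
      ultimately have "?m \<le> c ^ 3 * (rate ^ k / G) * (\<Delta> / 2)"
        unfolding G_def by (simp add: max_def)
      then show "\<bar>conditioned_law X d (\<pi>\<^sub>1 \<bind> P) t A - conditioned_law X d (\<pi>\<^sub>2 \<bind> P) t A\<bar>
          \<le> c ^ 3 * (rate ^ k / G) * (\<Delta> / 2)"
        by (simp add: mixture_conditioned \<pi> t A)
    qed
    also have "\<dots> = c ^ 3 * (rate ^ k / G) * \<Delta>" by simp
    also have "\<dots> \<le> c ^ 3 * ((1 - 1 / c ^ 5 * (\<integral>x. f x \<partial>\<mu>)) ^ k / G) * \<Delta>"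
      using \<Delta> G c_pos power_mono[OF rate_le rate_nonneg, of k]
      by (intro mult_right_mono mult_left_mono divide_right_mono) auto
    finally show ?thesis by (simp only: \<Delta>_def G_def k_def)
  qed

  moreover have qs: "quasi_stationary E d X P \<alpha> \<longleftrightarrow> invariant_law \<alpha>" for \<alpha>
    unfolding quasi_stationary_def invariant_law_def by (auto simp: mixture_conditioned)
  moreover have "\<exists>!\<alpha>. quasi_stationary E d X P \<alpha>"
    unfolding qs using invariant_law_limit_law invariant_law_unique by blast
  ultimately show ?thesis using invariant_law_bounds by auto
qed

end
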